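(* Let $\mu$ and $\nu$ be two probability measures on the real line, where $\nu$ is absolutely continuous. The following conditions are equivalent: (a) $\mu \leq_{cx} \nu$; (b) there exist real random variables $X$ and $Y$, defined on a common probability space, with marginal distributions $\mu$ and $\nu$ respectively, such that $\mathrm{E}(Y \mid X) = X$ and, with $\mu$-probability one, the conditional distribution of $Y$ given $X$ is either singular (i.e. $Y = X$) or absolutely continuous.
   Context: For two random variables $X$ and $Y$ with probability measures $\mu$ and $\nu$, we write $\mu \leq_{cx} \nu$ (equivalently $X \leq_{cx} Y$, "$X$ is less variable than $Y$ in the convex order") if $\mathrm{E}\{h(X)\} \leq \mathrm{E}\{h(Y)\}$ for every convex function $h:\mathbb{R}\to\mathbb{R}$ for which the expectations exist.
   Formalization: The convex order in (a) is taken to include that both laws have finite first moments, and Y in (b) is integrable; without this the equivalence fails, e.g. for μ a point mass at 0 and ν Cauchy. *)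

theory Defs
  imports "HOL-Probability.Probability"
begin

text \<open>Convex order between two probability laws on the real line.
  Following the standard convention, the convex order is a relation between
  laws with finite first moment; the defining inequality is required for every
  convex h for which both expectations exist (i.e. h is integrable for both).\<close>
definition cx_le :: "real measure \<Rightarrow> real measure \<Rightarrow> bool" where
  "cx_le \<mu> \<nu> \<longleftrightarrow>
     integrable \<mu> (\<lambda>x. x) \<and> integrable \<nu> (\<lambda>x. x) \<and>
     (\<forall>h::real \<Rightarrow> real. convex_on UNIV h \<and> integrable \<mu> h \<and> integrable \<nu> h
        \<longrightarrow> (\<integral>x. h x \<partial>\<mu>) \<le> (\<integral>x. h x \<partial>\<nu>))"

definition mart_coupling ::
  "'a measure \<Rightarrow> ('a \<Rightarrow> real) \<Rightarrow> ('a \<Rightarrow> real) \<Rightarrow> real measure \<Rightarrow> real measure \<Rightarrow> bool" where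
  "mart_coupling M X Y \<mu> \<nu> \<longleftrightarrow>
     prob_space M \<and> X \<in> borel_measurable M \<and> Y \<in> borel_measurable M \<and>
     distr M borel X = \<mu> \<and> distr M borel Y = \<nu> \<and>
     integrable M Y \<and>
     (AE \<omega> in M. real_cond_exp M (vimage_algebra (space M) X borel) Y \<omega> = X \<omega>) \<and>
     (\<exists>K :: real \<Rightarrow> real measure.
        K \<in> borel \<rightarrow>\<^sub>M prob_algebra borel \<and>
        (\<forall>A\<in>sets borel. \<forall>B\<in>sets borel.
           measure M {\<omega>\<in>space M. X \<omega> \<in> A \<and> Y \<omega> \<in> B}
             = (\<integral>x. indicator A x * measure (K x) B \<partial>\<mu>)) \<and>
        (AE x in \<mu>. K x = return borel x \<or> absolutely_continuous lborel (K x)))"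

end

theory Submission
  imports Defs
begin

text \<open>
  One direction is the conditional Jensen inequality. For the other, compare the potentials
  \<open>U t = \<integral>\<bar>x - t\<bar> d\<mu>\<close> and \<open>W t = \<integral>\<bar>x - t\<bar> d\<nu>\<close>; the convex order gives \<open>U \<le> W\<close>. Points of the
  contact set \<open>F = {U = W}\<close> do not move. The open set \<open>{U < W}\<close> is tiled by dyadic intervals so small
  that the chords of \<open>U\<close> stay below \<open>W\<close>, and each point of a tile is split to the two endpoints of its
  tile. The split law is \<open>\<mu>\<close> on \<open>F\<close> plus countably many atoms, and its potential still lies below \<open>W\<close>.
  Each atom in turn is spread over a piece of \<open>\<nu>\<close> of the same mass and mean, cut out by
  an interval of what is left of \<open>\<nu>\<close>; replacing a test function by its chord on that interval shows that the
  order survives the removal. What is left of \<open>\<nu>\<close> in the end has the same potential as the restriction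
  of \<open>\<mu>\<close> to \<open>F\<close>, hence equals it. Off \<open>F\<close> the resulting conditional laws are mixtures of two
  normalised pieces of \<open>\<nu>\<close>, so they are absolutely continuous.
\<close>

section \<open>Mass, mean and potential\<close>

text \<open>Staying put is forced on the contact set: equality in the conditional Jensen inequality
  for \<open>\<bar>y - t\<bar>\<close> forbids mass to cross a contact point t. Elsewhere the
  obstacle is that almost every single x needs a conditional law with a density, although x itself
  may have mass zero; embedding infinitesimal masses directly into \<nu> can send each of them to
  just two points. Routing x through a countable set of intermediate points removes this: almost
  surely every intermediate point that receives weight has positive mass, so it is given a piece of
  \<nu> of positive measure, and dividing by that measure yields a density. Splitting raises the
  potential, but only inside the tiles, and the strict gap between U and W there pays for it.
  Countability also allows the atoms to be embedded one at a time by induction. During that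
  induction the part of the split law still to be embedded is seen only through its mass, first
  moment and potential, which is all that the removal step uses.\<close>

text \<open>\<open>m\<close>, \<open>b\<close> and \<open>V\<close> behave like the mass, the first moment and the potential of a measure on
  the line that is never constructed.\<close>
definition pot :: "real \<Rightarrow> real \<Rightarrow> (real \<Rightarrow> real) \<Rightarrow> bool" where
  "pot m b V \<longleftrightarrow> 0 \<le> m \<and> (\<forall>t. \<bar>b - m * t\<bar> \<le> V t) \<and> convex_on UNIV V
     \<and> (\<forall>t r. V t \<le> V r + m * \<bar>r - t\<bar>) \<and> (m = 0 \<longrightarrow> (\<forall>t. V t = 0))"

lemma potD:
  assumes "pot m b V"
  shows "0 \<le> m" "\<bar>b - m * t\<bar> \<le> V t" "convex_on UNIV V" "V t \<le> V r + m * \<bar>r - t\<bar>"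
    "m = 0 \<Longrightarrow> V t = 0"
  using assms unfolding pot_def by blast+

lemma pot_convexD:
  assumes "pot m b V" "0 \<le> l" "0 \<le> k" "l + k = 1"
  shows "V (l * s + k * r) \<le> l * V s + k * V r"
proof -
  have "l = 1 - k" "k \<le> 1" using assms by auto
  then show ?thesis using convex_onD[OF potD(3)[OF assms(1)], of k s r] assms(3) by simp
qed

lemma pot_add:
  assumes "pot m b V" "pot m' b' V'"
  shows "pot (m + m') (b + b') (\<lambda>t. V t + V' t)"
  unfolding pot_def
proof (intro conjI allI impI)
  note a = potD[OF assms(1)] and b = potD[OF assms(2)]
  show "0 \<le> m + m'" using a(1) b(1) by simp
  show "\<bar>b + b' - (m + m') * t\<bar> \<le> V t + V' t" for t
    using a(2)[of t] b(2)[of t] by (simp add: algebra_simps)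
  show "convex_on UNIV (\<lambda>t. V t + V' t)" using a(3) b(3) by (rule convex_on_add)
  show "V t + V' t \<le> V r + V' r + (m + m') * \<bar>r - t\<bar>" for t r
    using a(4)[of t r] b(4)[of t r] by (simp add: algebra_simps)
  show "V t + V' t = 0" if "m + m' = 0" for t
    using that a(1,5) b(1,5) by (simp add: add_nonneg_eq_0_iff)
qed

lemma integrable_dist_weight:
  fixes W Z :: "'a \<Rightarrow> real"
  assumes "integrable M W" "integrable M (\<lambda>x. W x * Z x)" "\<And>x. 0 \<le> W x"
  shows "integrable M (\<lambda>x. W x * \<bar>Z x - t\<bar>)"
proof -
  have "integrable M (\<lambda>x. \<bar>W x * Z x - t * W x\<bar>)"
    using assms by (intro integrable_abs Bochner_Integration.integrable_diff integrable_mult_right)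
  also have "(\<lambda>x. \<bar>W x * Z x - t * W x\<bar>) = (\<lambda>x. W x * \<bar>Z x - t\<bar>)"
    using assms(3) by (simp add: fun_eq_iff mult.commute[of t] right_diff_distrib[symmetric] abs_mult)
  finally show ?thesis .
qed

text \<open>W is a weight and Z a position on an arbitrary space, so that one statement serves
  restrictions of a measure (W an indicator) as well as split mass (W a transport weight, Z its
  target).\<close>

lemma pot_integral:
  fixes W Z :: "'a \<Rightarrow> real"
  assumes i: "integrable M W" "integrable M (\<lambda>x. W x * Z x)" and W: "\<And>x. 0 \<le> W x"
  shows "pot (\<integral>x. W x \<partial>M) (\<integral>x. W x * Z x \<partial>M) (\<lambda>t. \<integral>x. W x * \<bar>Z x - t\<bar> \<partial>M)"
  unfolding pot_def
proof (intro conjI allI impI)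
  note d = integrable_dist_weight[OF i W]
  show "0 \<le> (\<integral>x. W x \<partial>M)" using W by simp
  show "\<bar>(\<integral>x. W x * Z x \<partial>M) - (\<integral>x. W x \<partial>M) * t\<bar> \<le> (\<integral>x. W x * \<bar>Z x - t\<bar> \<partial>M)" for t
  proof -
    have "(\<integral>x. W x * Z x \<partial>M) - (\<integral>x. W x \<partial>M) * t = (\<integral>x. W x * (Z x - t) \<partial>M)"
      using i by (simp add: right_diff_distrib)
    also have "\<bar>\<dots>\<bar> \<le> (\<integral>x. \<bar>W x * (Z x - t)\<bar> \<partial>M)" by (rule integral_abs_bound)
    finally show ?thesis using W by (simp add: abs_mult)
  qed
  show "convex_on UNIV (\<lambda>t. \<integral>x. W x * \<bar>Z x - t\<bar> \<partial>M)"
  proof (rule convex_onI)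
    fix l s r :: real assume l: "0 < l" "l < 1"
    have "(\<integral>x. W x * \<bar>Z x - ((1 - l) *\<^sub>R s + l *\<^sub>R r)\<bar> \<partial>M)
      \<le> (\<integral>x. (1 - l) * (W x * \<bar>Z x - s\<bar>) + l * (W x * \<bar>Z x - r\<bar>) \<partial>M)"
    proof (rule integral_mono)
      fix x
      have "\<bar>Z x - ((1 - l) *\<^sub>R s + l *\<^sub>R r)\<bar> = \<bar>(1 - l) * (Z x - s) + l * (Z x - r)\<bar>"
        by (simp add: algebra_simps)
      also have "\<dots> \<le> (1 - l) * \<bar>Z x - s\<bar> + l * \<bar>Z x - r\<bar>"
        using l abs_triangle_ineq[of "(1 - l) * (Z x - s)" "l * (Z x - r)"] by (simp add: abs_mult)
      finally have "W x * \<bar>Z x - ((1 - l) *\<^sub>R s + l *\<^sub>R r)\<bar>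
          \<le> W x * ((1 - l) * \<bar>Z x - s\<bar> + l * \<bar>Z x - r\<bar>)"
        using W by (intro mult_left_mono)
      then show "W x * \<bar>Z x - ((1 - l) *\<^sub>R s + l *\<^sub>R r)\<bar>
          \<le> (1 - l) * (W x * \<bar>Z x - s\<bar>) + l * (W x * \<bar>Z x - r\<bar>)" by (simp add: algebra_simps)
    qed (intro d Bochner_Integration.integrable_add integrable_mult_right)+
    then show "(\<integral>x. W x * \<bar>Z x - ((1 - l) *\<^sub>R s + l *\<^sub>R r)\<bar> \<partial>M)
      \<le> (1 - l) * (\<integral>x. W x * \<bar>Z x - s\<bar> \<partial>M) + l * (\<integral>x. W x * \<bar>Z x - r\<bar> \<partial>M)"
      using d by simp
  qed simp
  show "(\<integral>x. W x * \<bar>Z x - t\<bar> \<partial>M) \<le> (\<integral>x. W x * \<bar>Z x - r\<bar> \<partial>M) + (\<integral>x. W x \<partial>M) * \<bar>r - t\<bar>" for t r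
  proof -
    have "(\<integral>x. W x * \<bar>Z x - t\<bar> \<partial>M) \<le> (\<integral>x. W x * \<bar>Z x - r\<bar> + W x * \<bar>r - t\<bar> \<partial>M)"
    proof (rule integral_mono)
      fix x
      have "W x * \<bar>Z x - t\<bar> \<le> W x * (\<bar>Z x - r\<bar> + \<bar>r - t\<bar>)"
        using W by (intro mult_left_mono) auto
      then show "W x * \<bar>Z x - t\<bar> \<le> W x * \<bar>Z x - r\<bar> + W x * \<bar>r - t\<bar>"
        by (simp add: algebra_simps)
    qed (use d i in auto)
    then show ?thesis using d i by simp
  qed
  show "(\<integral>x. W x * \<bar>Z x - t\<bar> \<partial>M) = 0" if "(\<integral>x. W x \<partial>M) = 0" for t
  proof -
    have "AE x in M. W x = 0" using that integral_nonneg_eq_0_iff_AE[OF i(1)] W by simp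
    then show ?thesis by (intro integral_eq_zero_AE) auto
  qed
qed

lemma integrable_indicator_times:
  fixes f :: "'a \<Rightarrow> real"
  assumes "integrable M f" "A \<in> sets M"
  shows "integrable M (\<lambda>x. indicator A x * f x)"
  using integrable_mult_indicator[OF assms(2,1)] by simp

lemma pot_indicator:
  fixes f :: "'a \<Rightarrow> real"
  assumes "finite_measure M" "integrable M Z" "A \<in> sets M"
  shows "pot (measure M A) (\<integral>x. indicator A x * Z x \<partial>M) (\<lambda>t. \<integral>x. indicator A x * \<bar>Z x - t\<bar> \<partial>M)"
proof -
  interpret finite_measure M by fact
  have "integrable M (indicator A :: _ \<Rightarrow> real)"
    using assms(3) by (simp add: integrable_indicator_iff emeasure_eq_measure)
  from pot_integral[OF this integrable_indicator_times[OF assms(2,3)]] show ?thesis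
    using assms(3) by (simp add: sets.Int_space_eq1)
qed

section \<open>Uniqueness of a measure with given mass, mean and potential\<close>

text \<open>As \<open>max 0 y\<close> is half of \<open>\<bar>y\<bar> + y\<close>, the three data
  determine the integral of every \<open>max 0 (x - s)\<close>. Difference quotients of these in s
  converge to indicators of open half-lines, and open half-lines determine a finite measure.\<close>

lemma finite_measure_eqI_potential:
  fixes M N :: "real measure"
  assumes fin: "finite_measure M" "finite_measure N" and S: "sets M = sets borel" "sets N = sets borel"
    and int: "integrable M (\<lambda>x. x)" "integrable N (\<lambda>x. x)"
    and mass: "measure M (space M) = measure N (space N)"
    and mean: "(\<integral>x. x \<partial>M) = (\<integral>x. x \<partial>N)"
    and V: "\<And>t. (\<integral>x. \<bar>x - t\<bar> \<partial>M) = (\<integral>x. \<bar>x - t\<bar> \<partial>N)"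
  shows "M = N"
proof (rule measure_eqI_lessThan[OF S])
  define d where "d n = 1 / real (Suc n)" for n
  \<comment> \<open>A ramp that vanishes up to t and equals 1 from \<open>t + d n\<close> on. It
    rises to the right of t, so the limit at t itself is 0, as for the open half-line.\<close>
  define f where "f n t x = (max 0 (x - t) - max 0 (x - t - d n)) / d n" for n t and x :: real
  have d: "0 < d n" for n by (simp add: d_def)
  interpret M: finite_measure M by fact
  interpret N: finite_measure N by fact
  have max: "max 0 y = (\<bar>y\<bar> + y) / 2" for y :: real by (simp add: max_def)
  have I: "integrable M (\<lambda>x. max 0 (x - s))" "integrable N (\<lambda>x. max 0 (x - s))" for s
    unfolding max using int by auto
  have "(\<integral>x. max 0 (x - s) \<partial>M) = (\<integral>x. max 0 (x - s) \<partial>N)" for s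
    unfolding max using int mass mean V[of s] by simp
  then have 1: "(\<integral>x. f n t x \<partial>M) = (\<integral>x. f n t x \<partial>N)" for n t
    unfolding f_def diff_diff_eq using I by simp
  have lim: "(\<lambda>n. f n t x) \<longlonglongrightarrow> indicator {t<..} x" for t x
  proof (rule tendsto_eventually, cases "x > t")
    case True
    obtain n0 where n0: "d n0 < x - t" using True nat_approx_posE[of "x - t"] by (auto simp: d_def)
    show "\<forall>\<^sub>F n in sequentially. f n t x = indicator {t<..} x"
    proof (rule eventually_sequentiallyI)
      fix n assume "n0 \<le> n"
      then have "d n \<le> d n0" unfolding d_def by (intro divide_left_mono) auto
      then show "f n t x = indicator {t<..} x" using n0 True d[of n]
        by (simp add: f_def max_def)
    qed
  next
    case False
    have "f n t x = 0" for n using False d[of n] by (simp add: f_def max_def)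
    then show "\<forall>\<^sub>F n in sequentially. f n t x = indicator {t<..} x" using False by simp
  qed
  have bd: "\<bar>f n t x\<bar> \<le> 1" for n t x
    using d[of n] by (simp add: f_def max_def abs_le_iff)
  have 2: "(\<lambda>n. \<integral>x. f n t x \<partial>L) \<longlonglongrightarrow> measure L {t<..}"
    if "finite_measure L" "sets L = sets borel" for L t
  proof -
    interpret L: finite_measure L by fact
    have [measurable_cong]: "sets L = sets borel" by fact
    have "(\<lambda>n. \<integral>x. f n t x \<partial>L) \<longlonglongrightarrow> (\<integral>x. indicator {t<..} x \<partial>L)"
      by (rule integral_dominated_convergence[where w = "\<lambda>_. 1"])
         (use bd lim in \<open>auto simp: f_def[abs_def]\<close>)
    then show ?thesis using that by (simp add: sets_eq_imp_space_eq)
  qed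
  have "measure M {t<..} = measure N {t<..}" for t
    using 2[OF fin(1) S(1), of t] 2[OF fin(2) S(2), of t] unfolding 1 by (rule LIMSEQ_unique)
  then show "emeasure M {t<..} = emeasure N {t<..}" for t
    by (simp add: M.emeasure_eq_measure N.emeasure_eq_measure)
  show "emeasure M {t<..} < \<infinity>" for t by (simp add: M.emeasure_eq_measure)
qed

context finite_borel_measure
begin

context
  fixes A N
  assumes A[measurable]: "A \<in> sets borel"
  defines "N \<equiv> density M (\<lambda>x. ennreal (indicator A x))"
begin

lemma emeasure_density_indicator:
  assumes [measurable]: "B \<in> sets borel"
  shows "emeasure N B = emeasure M (A \<inter> B)"
proof -
  note [measurable_cong] = M_is_borel
  have "emeasure N B = (\<integral>\<^sup>+x. ennreal (indicator A x) * indicator B x \<partial>M)"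
    unfolding N_def by (subst emeasure_density) auto
  also have "\<dots> = (\<integral>\<^sup>+x. indicator (A \<inter> B) x \<partial>M)"
    by (intro nn_integral_cong) (auto split: split_indicator)
  finally show ?thesis by simp
qed

lemma finite_borel_density_indicator: "finite_borel_measure N"
proof -
  have S: "sets N = sets borel" by (simp add: N_def M_is_borel)
  have U: "space N = UNIV" using sets_eq_imp_space_eq[OF S] by simp
  interpret N: finite_measure N
    by (rule finite_measureI) (simp add: U emeasure_density_indicator emeasure_eq_measure)
  show ?thesis by unfold_locales (rule S)
qed

lemma integral_density_indicator:
  fixes f :: "real \<Rightarrow> real"
  assumes [measurable]: "f \<in> borel_measurable borel"
  shows "(\<integral>x. f x \<partial>N) = (\<integral>x. indicator A x * f x \<partial>M)"
proof -
  note [measurable_cong] = M_is_borel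
  show ?thesis unfolding N_def by (subst integral_real_density) auto
qed

lemma integrable_density_indicator:
  fixes f :: "real \<Rightarrow> real"
  assumes "integrable M f"
  shows "integrable N f"
proof -
  note [measurable_cong] = M_is_borel
  have [measurable]: "f \<in> borel_measurable M" using assms by auto
  have "integrable M (\<lambda>x. indicator A x * f x)"
    using assms by (rule integrable_indicator_times) measurable
  then show ?thesis unfolding N_def by (subst integrable_real_density) auto
qed

end

end

lemma emeasure_Int_eqI_potential:
  assumes M: "finite_borel_measure M" "integrable M (\<lambda>x. x)" and N: "finite_borel_measure N" "integrable N (\<lambda>x. x)"
    and AB: "A \<in> sets borel" "B \<in> sets borel"
    and mass: "measure M A = measure N B"
    and mean: "(\<integral>x. indicator A x * x \<partial>M) = (\<integral>x. indicator B x * x \<partial>N)"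
    and V: "\<And>t. (\<integral>x. indicator A x * \<bar>x - t\<bar> \<partial>M) = (\<integral>x. indicator B x * \<bar>x - t\<bar> \<partial>N)"
    and C: "C \<in> sets borel"
  shows "emeasure M (A \<inter> C) = emeasure N (B \<inter> C)"
proof -
  interpret M: finite_borel_measure M by fact
  interpret N: finite_borel_measure N by fact
  let ?M = "density M (\<lambda>x. ennreal (indicator A x))" and ?N = "density N (\<lambda>x. ennreal (indicator B x))"
  interpret M': finite_borel_measure ?M by (rule M.finite_borel_density_indicator[OF AB(1)])
  interpret N': finite_borel_measure ?N by (rule N.finite_borel_density_indicator[OF AB(2)])
  have "?M = ?N"
  proof (rule finite_measure_eqI_potential)
    show "measure ?M (space ?M) = measure ?N (space ?N)"
      using mass unfolding M'.borel_UNIV N'.borel_UNIV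
      by (simp add: measure_def M.emeasure_density_indicator N.emeasure_density_indicator AB)
    have meas: "(\<lambda>x::real. x) \<in> borel_measurable borel" "(\<lambda>x::real. \<bar>x - t\<bar>) \<in> borel_measurable borel" for t
      by measurable
    note Mi = M.integral_density_indicator[OF AB(1)] and Ni = N.integral_density_indicator[OF AB(2)]
    show "(\<integral>x. x \<partial>?M) = (\<integral>x. x \<partial>?N)"
      unfolding Mi[OF meas(1)] Ni[OF meas(1)] by (rule mean)
    show "(\<integral>x. \<bar>x - t\<bar> \<partial>?M) = (\<integral>x. \<bar>x - t\<bar> \<partial>?N)" for t
      unfolding Mi[OF meas(2)] Ni[OF meas(2)] by (rule V)
  qed (fact M'.finite_measure_axioms N'.finite_measure_axioms M'.M_is_borel N'.M_is_borel
      M.integrable_density_indicator[OF AB(1) M(2)] N.integrable_density_indicator[OF AB(2) N(2)])+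
  then show ?thesis
    using M.emeasure_density_indicator[OF AB(1) C] N.emeasure_density_indicator[OF AB(2) C] by simp
qed

section \<open>Embedding an atom into an atomless measure\<close>

context finite_borel_measure
begin

text \<open>Sublevel sets of the continuous cdf cut off a prescribed mass u from the left. The empty
  alternative occurs when u = 0 and the cdf is positive everywhere; for u the total mass the
  sublevel set is the whole line.\<close>

lemma cdf_sublevel:
  assumes atomless: "\<And>x. measure M {x} = 0" and u: "0 \<le> u" "u < measure M (space M)"
  shows "u = 0 \<and> {x. cdf M x \<le> u} = {} \<or> (\<exists>r. {x. cdf M x \<le> u} = {..r} \<and> measure M {..r} = u)"
proof -
  have cont: "continuous_on S (cdf M)" for S
    using isCont_cdf atomless by (simp add: continuous_at_imp_continuous_on)
  define L where "L = {x. cdf M x \<le> u}"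
  have "closed L" unfolding L_def by (intro closed_Collect_le cont continuous_on_const)
  obtain X where X: "cdf M x > u" if "X \<le> x" for x
    using order_tendstoD(1)[OF cdf_lim_at_top u(2)] by (auto simp: eventually_at_top_linorder)
  have bdd: "bdd_above L"
    unfolding L_def by (rule bdd_aboveI[of _ X]) (use X in \<open>force simp: not_less[symmetric]\<close>)
  show ?thesis
  proof (cases "L = {}")
    case True
    have "\<not> 0 < u"
    proof
      assume "0 < u"
      from order_tendstoD(2)[OF cdf_lim_at_bot this] obtain x where "cdf M x < u"
        by (auto simp: eventually_at_bot_linorder)
      then have "x \<in> L" by (simp add: L_def)
      with True show False by simp
    qed
    with True u show ?thesis by (auto simp: L_def)
  next
    case False
    define r where "r = Sup L"
    have r: "r \<in> L" unfolding r_def using \<open>closed L\<close> bdd False by (intro closed_contains_Sup)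
    have le: "x \<le> r" if "x \<in> L" for x unfolding r_def using bdd that by (rule cSup_upper[rotated])
    have "r \<le> X" using X[of r] r by (force simp: L_def)
    \<comment> \<open>A point at or beyond r with value exactly u belongs to L, whose supremum is r;
      hence it is r.\<close>
    then obtain y where y: "r \<le> y" "cdf M y = u"
      using IVT'[of "cdf M" r u X] r X[of X] cont by (auto simp: L_def)
    then have "y = r" using le[of y] by (simp add: L_def)
    moreover have "L = {..r}"
    proof safe
      fix x assume "x \<le> r"
      from cdf_nondecreasing[OF this] r show "x \<in> L" by (simp add: L_def)
    qed (use le in simp)
    ultimately show ?thesis using y by (auto simp: L_def cdf_def)
  qed
qed

lemma cdf_total_sublevel: "{x. cdf M x \<le> measure M (space M)} = UNIV"
  using cdf_bounded by auto

lemma measure_cdf_sublevel: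
  assumes "\<And>x. measure M {x} = 0" and u: "0 \<le> u" "u \<le> measure M (space M)"
  shows "measure M {x. cdf M x \<le> u} = u"
proof (cases "u = measure M (space M)")
  case True
  then show ?thesis using cdf_total_sublevel borel_UNIV by simp
next
  case False
  with u cdf_sublevel[OF assms(1), of u] show ?thesis by auto
qed

text \<open>\<open>B u\<close> is the first moment of the lowest mass u. A window of mass \<alpha>
  slides from the left end of M to the right end; its first moment changes continuously, so every
  value between the extremes is attained.\<close>

lemma interval_with_mean:
  assumes atomless: "\<And>x. measure M {x} = 0" and int: "integrable M (\<lambda>x. x)"
    and \<alpha>: "0 \<le> \<alpha>" "\<alpha> \<le> measure M (space M)"
  defines "B \<equiv> \<lambda>u. \<integral>x. indicator {x. cdf M x \<le> u} x * x \<partial>M"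
  assumes c: "B \<alpha> \<le> c" "c \<le> B (measure M (space M)) - B (measure M (space M) - \<alpha>)"
  obtains u where "0 \<le> u" "u + \<alpha> \<le> measure M (space M)" "B (u + \<alpha>) - B u = c"
proof -
  let ?m = "measure M (space M)"
  note [measurable_cong] = M_is_borel
  have [measurable]: "cdf M \<in> borel_measurable borel"
    by (intro borel_measurable_mono monoI cdf_nondecreasing)
  have meas: "measure M {x. cdf M x \<le> u} = u" if "0 \<le> u" "u \<le> ?m" for u
    by (rule measure_cdf_sublevel[OF atomless that])
  \<comment> \<open>A level set of the cdf may be an interval, namely a gap of M. It lies between
    sublevel sets of masses v and a with v arbitrarily close to a, so it is null; this gives the
    continuity of B by dominated convergence.\<close>
  have null: "measure M {x. cdf M x = a} = 0" if a: "0 \<le> a" "a \<le> ?m" for a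
  proof -
    have le: "measure M {x. cdf M x = a} \<le> a - v" if "0 \<le> v" "v < a" for v
    proof -
      have "measure M {x. cdf M x = a} \<le> measure M ({x. cdf M x \<le> a} - {x. cdf M x \<le> v})"
        using that by (intro finite_measure_mono) auto
      also have "\<dots> = a - v"
        using that a meas by (subst finite_measure_Diff) auto
      finally show ?thesis .
    qed
    have "measure M {x. cdf M x = a} \<le> 0"
    proof (cases "a = 0")
      case True
      have "measure M {x. cdf M x = a} \<le> measure M {x. cdf M x \<le> a}"
        by (intro finite_measure_mono) auto
      with True meas[of 0] a show ?thesis by simp
    next
      case False
      show ?thesis
      proof (rule field_le_epsilon)
        fix e :: real assume "0 < e"
        then show "measure M {x. cdf M x = a} \<le> 0 + e"
          using le[of "a - e"] le[of 0] False a by (cases "e \<le> a") auto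
      qed
    qed
    then show ?thesis by (simp add: measure_le_0_iff)
  qed
  have cont: "continuous_on {0..?m} B"
  proof (rule continuous_on_sequentiallyI)
    fix v a assume v: "\<forall>n. v n \<in> {0..?m}" and a: "a \<in> {0..?m}" and lim: "v \<longlonglongrightarrow> a"
    have "AE x in M. cdf M x \<noteq> a"
      using null[of a] a
      by (subst AE_iff_measurable[OF _ refl]) (auto simp: emeasure_eq_measure borel_UNIV)
    then have ae: "AE x in M. (\<lambda>n. indicator {x. cdf M x \<le> v n} x * x) \<longlonglongrightarrow> indicator {x. cdf M x \<le> a} x * x"
    proof eventually_elim
      case (elim x)
      have "\<forall>\<^sub>F n in sequentially. (cdf M x \<le> v n) = (cdf M x \<le> a)"
      proof (cases "cdf M x < a")
        case True
        from order_tendstoD(1)[OF lim this] show ?thesis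
          by eventually_elim (use True in auto)
      next
        case False
        with elim have "a < cdf M x" by simp
        from order_tendstoD(2)[OF lim this] show ?thesis
          by eventually_elim (use \<open>a < cdf M x\<close> in auto)
      qed
      then have "\<forall>\<^sub>F n in sequentially. indicator {x. cdf M x \<le> v n} x * x = indicator {x. cdf M x \<le> a} x * x"
        by eventually_elim (simp add: indicator_def)
      then show ?case by (rule tendsto_eventually)
    qed
    show "(\<lambda>n. B (v n)) \<longlonglongrightarrow> B a" unfolding B_def
    proof (rule integral_dominated_convergence[OF _ _ _ ae])
      show "integrable M (\<lambda>x. \<bar>x\<bar>)" using int by simp
      show "AE x in M. norm (indicator {x. cdf M x \<le> v n} x * x) \<le> \<bar>x\<bar>" for n
        by (auto split: split_indicator)
    qed measurable
  qed
  have 0: "B 0 = 0"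
  proof -
    have "AE x in M. x \<notin> {x. cdf M x \<le> 0}"
      using meas[of 0]
      by (subst AE_iff_measurable[OF _ refl]) (auto simp: emeasure_eq_measure borel_UNIV)
    then show ?thesis unfolding B_def by (intro integral_eq_zero_AE) (auto simp: indicator_def)
  qed
  have "\<exists>u\<ge>0. u \<le> ?m - \<alpha> \<and> B (u + \<alpha>) - B u = c"
  proof (rule IVT')
    show "continuous_on {0..?m - \<alpha>} (\<lambda>u. B (u + \<alpha>) - B u)"
      using \<alpha> by (intro continuous_on_diff continuous_on_compose2[OF cont] continuous_intros) auto
  qed (use 0 c \<alpha> in auto)
  then show ?thesis using that by (auto simp: algebra_simps)
qed

text \<open>Here \<open>g\<close> is the distance to \<open>t\<close> with its values on \<open>J\<close> replaced by an affine function.\<close>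
lemma potential_remove:
  assumes int: "integrable M (\<lambda>x. x)" and pot: "pot m b V"
    and mass: "\<alpha> + m = measure M (space M)"
    and V: "\<And>t. \<alpha> * \<bar>p - t\<bar> + V t \<le> (\<integral>x. \<bar>x - t\<bar> \<partial>M)"
    and J: "J \<in> sets borel" "measure M J = \<alpha>" "(\<integral>x. indicator J x * x \<partial>M) = \<alpha> * p"
    and lk: "0 \<le> l" "0 \<le> k"
    and g: "g = (\<lambda>x. l * \<bar>x - s\<bar> + k * \<bar>x - r\<bar> + c)"
    and affine: "\<And>x. x \<in> insert p J \<Longrightarrow> g x = A * x + D"
    and off: "\<And>x. x \<notin> J \<Longrightarrow> g x = \<bar>x - t\<bar>"
    and Vt: "V t \<le> l * V s + k * V r + c * m"
  shows "V t \<le> (\<integral>x. indicator (- J) x * \<bar>x - t\<bar> \<partial>M)"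
proof -
  have [simp]: "J \<in> sets M" "- J \<in> sets M" using J by auto
  have i: "integrable M (\<lambda>x. \<bar>x - t\<bar>)" for t using int by simp
  have ig: "integrable M g" unfolding g using i by simp
  \<comment> \<open>The constant c meets the total mass \<open>\<alpha> + m\<close>: the share
    \<open>c * m\<close> is used up by \<open>Vt\<close>, and \<open>c * \<alpha>\<close> goes into
    \<open>\<alpha> * g p\<close>. The assumed domination at s and r, weighted by l and k, supplies
    the rest.\<close>
  have "(\<integral>x. g x \<partial>M) = l * (\<integral>x. \<bar>x - s\<bar> \<partial>M) + k * (\<integral>x. \<bar>x - r\<bar> \<partial>M) + c * (\<alpha> + m)"
    unfolding g using i mass by simp
  moreover have "l * (\<alpha> * \<bar>p - s\<bar> + V s) \<le> l * (\<integral>x. \<bar>x - s\<bar> \<partial>M)"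
    "k * (\<alpha> * \<bar>p - r\<bar> + V r) \<le> k * (\<integral>x. \<bar>x - r\<bar> \<partial>M)"
    using V lk by (auto intro: mult_left_mono)
  ultimately have 1: "\<alpha> * g p + V t \<le> (\<integral>x. g x \<partial>M)"
    using Vt by (simp add: g algebra_simps)
  \<comment> \<open>An affine function sees only mass and mean, so the piece J and an atom \<alpha>
    at p contribute equally and cancel.\<close>
  have "(\<integral>x. indicator J x * g x \<partial>M) = (\<integral>x. A * (indicator J x * x) + D * indicator J x \<partial>M)"
    by (intro Bochner_Integration.integral_cong) (auto simp: affine indicator_def)
  also have "\<dots> = A * (\<integral>x. indicator J x * x \<partial>M) + D * measure M J"
    using integrable_indicator_times[OF int, of J]
    by (simp add: integrable_indicator_iff emeasure_eq_measure borel_UNIV)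
  also have "\<dots> = \<alpha> * g p" using J affine[of p] by (simp add: algebra_simps)
  finally have 2: "(\<integral>x. indicator J x * g x \<partial>M) = \<alpha> * g p" .
  have "(\<integral>x. g x \<partial>M) = (\<integral>x. indicator J x * g x + indicator (- J) x * g x \<partial>M)"
    by (intro Bochner_Integration.integral_cong) (auto simp: indicator_def)
  also have "\<dots> = \<alpha> * g p + (\<integral>x. indicator (- J) x * g x \<partial>M)"
    using integrable_indicator_times[OF ig] 2 by simp
  also have "(\<integral>x. indicator (- J) x * g x \<partial>M) = (\<integral>x. indicator (- J) x * \<bar>x - t\<bar> \<partial>M)"
    by (intro Bochner_Integration.integral_cong) (auto dest: off split: split_indicator)
  finally show ?thesis using 1 by simp
qed

end

text \<open>The interval is \<open>{x. u < cdf M x \<le> u + \<alpha>}\<close>, with \<open>u\<close> chosen by the intermediate value theorem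
  to match the mean; it is a half-line when \<open>u\<close> is extremal.\<close>
lemma (in finite_borel_measure) shadow:
  assumes atomless: "\<And>x. measure M {x} = 0" and int: "integrable M (\<lambda>x. x)"
    and pot: "pot m b V" and \<alpha>: "0 \<le> \<alpha>"
    and mass: "\<alpha> + m = measure M (space M)" and mean: "\<alpha> * p + b = (\<integral>x. x \<partial>M)"
    and V: "\<And>t. \<alpha> * \<bar>p - t\<bar> + V t \<le> (\<integral>x. \<bar>x - t\<bar> \<partial>M)"
  obtains J where "J \<in> sets borel" "measure M J = \<alpha>" "(\<integral>x. indicator J x * x \<partial>M) = \<alpha> * p"
    "\<And>t. V t \<le> (\<integral>x. indicator (- J) x * \<bar>x - t\<bar> \<partial>M)"
proof -
  note potm = potD[OF pot]
  note [measurable_cong] = M_is_borel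
  consider "\<alpha> = 0" | "m = 0" | "0 < \<alpha>" "0 < m" using \<alpha> potm(1) by linarith
  then show thesis
  proof cases
    case 1
    show thesis by (rule that[of "{}"]) (use 1 V in auto)
  next
    case 2
    have "b = 0" using potm(2)[of 0] potm(5)[OF 2] by simp
    then show thesis using that[of UNIV] 2 mass mean potm(5)[OF 2] borel_UNIV by simp
  next
    case 3
    let ?m = "measure M (space M)"
    let ?L = "\<lambda>u. {x. cdf M x \<le> u}"
    define B where "B = (\<lambda>u. \<integral>x. indicator (?L u) x * x \<partial>M)"
    have [measurable]: "cdf M \<in> borel_measurable borel"
      by (intro borel_measurable_mono monoI cdf_nondecreasing)
    have [simp]: "integrable M (indicat_real S)" if "S \<in> sets borel" for S
      using that by (simp add: integrable_indicator_iff emeasure_eq_measure)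
    have Bm: "B ?m = \<alpha> * p + b" unfolding B_def cdf_total_sublevel using mean by simp
    \<comment> \<open>At a cut point r with mass u to its left, the potential is explicit in the
      moment \<open>B u\<close>, so bounds on potentials become bounds on B.\<close>
    have dist: "(\<integral>x. \<bar>x - r\<bar> \<partial>M) = 2 * (u * r - B u) + (\<alpha> * p + b) - ?m * r"
      if "?L u = {..r}" "measure M {..r} = u" for u r
    proof -
      have "(\<integral>x. \<bar>x - r\<bar> \<partial>M)
        = (\<integral>x. 2 * (r * indicator {..r} x - indicator {..r} x * x) + (x - r) \<partial>M)"
        by (intro Bochner_Integration.integral_cong) (auto simp: indicator_def)
      also have "\<dots> = 2 * (r * measure M {..r} - B u) + (\<alpha> * p + b) - ?m * r"
        using int integrable_indicator_times[OF int, of "{..r}"] that(1) mean borel_UNIV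
        by (simp add: B_def)
      finally show ?thesis using that(2) by (simp add: mult.commute)
    qed
    \<comment> \<open>The leftmost window has mean at most p: at its cut point r, combine the
      domination with \<open>V r \<ge> b - m * r\<close>. For the rightmost window the cut point s
      has mass m to its left, and the bound used is \<open>V s \<ge> m * s - b\<close>.\<close>
    obtain r where r: "?L \<alpha> = {..r}" "measure M {..r} = \<alpha>"
      using cdf_sublevel[OF atomless, of \<alpha>] 3 mass by auto
    have "\<alpha> * (r - p) \<le> \<alpha> * \<bar>p - r\<bar>" using \<alpha> by (intro mult_left_mono) auto
    then have c1: "B \<alpha> \<le> \<alpha> * p"
      using V[of r] potm(2)[of r] dist[OF r] unfolding mass[symmetric] by (simp add: algebra_simps)
    obtain s where s: "?L m = {..s}" "measure M {..s} = m"
      using cdf_sublevel[OF atomless, of m] 3 mass by auto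
    have "\<alpha> * (p - s) \<le> \<alpha> * \<bar>p - s\<bar>" using \<alpha> by (intro mult_left_mono) auto
    then have "B m \<le> b"
      using V[of s] potm(2)[of s] dist[OF s] unfolding mass[symmetric] by (simp add: algebra_simps)
    then have c2: "\<alpha> * p \<le> B ?m - B (?m - \<alpha>)" using Bm mass[symmetric] by simp
    obtain u where u: "0 \<le> u" "u + \<alpha> \<le> ?m" "B (u + \<alpha>) - B u = \<alpha> * p"
      by (rule interval_with_mean[OF atomless int \<alpha> _ c1[unfolded B_def] c2[unfolded B_def]])
         (use 3 mass in \<open>auto simp: B_def\<close>)
    define J where "J = ?L (u + \<alpha>) - ?L u"
    have [measurable]: "J \<in> sets borel" unfolding J_def by measurable
    have sub: "?L u \<subseteq> ?L (u + \<alpha>)" using \<alpha> by auto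
    have "measure M J = measure M (?L (u + \<alpha>)) - measure M (?L u)"
      unfolding J_def using sub by (intro finite_measure_Diff) auto
    then have measJ: "measure M J = \<alpha>" using u \<alpha> measure_cdf_sublevel[OF atomless] by simp
    have "(\<integral>x. indicator J x * x \<partial>M)
        = (\<integral>x. indicator (?L (u + \<alpha>)) x * x - indicator (?L u) x * x \<partial>M)"
      using sub unfolding J_def
      by (intro Bochner_Integration.integral_cong) (auto simp: indicator_def)
    also have "\<dots> = \<alpha> * p"
      using integrable_indicator_times[OF int] u(3) unfolding B_def by simp
    finally have meanJ: "(\<integral>x. indicator J x * x \<partial>M) = \<alpha> * p" .
    have iJ: "integrable M (\<lambda>x. indicator J x * x)" "integrable M (\<lambda>x. indicator J x * c)" for c :: real
      using integrable_indicator_times[OF int, of J] integrable_indicator_times[of M "\<lambda>_. c" J] by auto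
    have p_le: "p \<le> r" if "J \<subseteq> {..r}" for r
    proof -
      have "(\<integral>x. indicator J x * x \<partial>M) \<le> (\<integral>x. indicator J x * r \<partial>M)"
        using that by (intro integral_mono iJ) (auto simp: indicator_def)
      then show ?thesis using meanJ measJ 3 by simp
    qed
    have p_ge: "s \<le> p" if "J \<subseteq> {s..}" for s
    proof -
      have "(\<integral>x. indicator J x * s \<partial>M) \<le> (\<integral>x. indicator J x * x \<partial>M)"
        using that by (intro integral_mono iJ) (auto simp: indicator_def)
      then show ?thesis using meanJ measJ 3 by simp
    qed
    note remove = potential_remove[OF int pot mass V \<open>J \<in> sets borel\<close> measJ meanJ _ _ refl]
    \<comment> \<open>With t to one side of J, and hence of p, the distance to t is already affine
      there, so g is the distance itself.\<close>
    have below: "V t \<le> (\<integral>x. indicator (- J) x * \<bar>x - t\<bar> \<partial>M)" if "J \<subseteq> {..t}" for t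
      by (rule remove[where l = 1 and k = 0 and s = t and r = 0 and c = 0 and A = "-1" and D = t])
         (use that p_le[OF that] in auto)
    have above: "V t \<le> (\<integral>x. indicator (- J) x * \<bar>x - t\<bar> \<partial>M)" if "J \<subseteq> {t..}" for t
      by (rule remove[where l = 1 and k = 0 and s = t and r = 0 and c = 0 and A = 1 and D = "-t"])
         (use that p_ge[OF that] in auto)
    have R: "?L (u + \<alpha>) = UNIV \<and> u + \<alpha> = ?m \<or> (\<exists>r. ?L (u + \<alpha>) = {..r})"
      using cdf_sublevel[OF atomless, of "u + \<alpha>"] cdf_total_sublevel u 3 by (cases "u + \<alpha> = ?m") auto
    have S: "?L u = {} \<and> u = 0 \<or> (\<exists>s. ?L u = {..s})"
      using cdf_sublevel[OF atomless, of u] u 3 by auto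
    \<comment> \<open>Since m > 0, some mass stays outside J, so J cannot be unbounded on both
      sides.\<close>
    consider (left) r where "J = {..r}" | (mid) s r where "J = {s<..r}" | (right) s where "J = {s<..}"
    proof -
      have ne: "\<not> (u = 0 \<and> u + \<alpha> = ?m)" using 3 mass by linarith
      have Diff: "{..r} - {..s} = {s<..r}" "UNIV - {..s} = {s<..}" for r s :: real by auto
      from R S ne that show thesis unfolding J_def by (elim disjE conjE exE) (auto simp: Diff)
    qed
    then have "V t \<le> (\<integral>x. indicator (- J) x * \<bar>x - t\<bar> \<partial>M)" for t
    proof cases
      case left
      show ?thesis
      proof (cases "r \<le> t")
        case True
        with left show ?thesis by (intro below) auto
      next
        case False
        \<comment> \<open>Here g is the distance to r raised by \<open>r - t\<close>: it agrees with
          the distance to t beyond r and is continued with slope -1 on J. The Lipschitz bound of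
          \<open>pot\<close> controls V. The right half-line is the mirror image.\<close>
        have "p \<le> r" using left by (intro p_le) auto
        show ?thesis
          by (rule remove[where l = 0 and k = 1 and s = 0 and r = r and c = "r - t" and A = "-1" and D = "2 * r - t"])
             (use left False \<open>p \<le> r\<close> potm(4)[of t r] in \<open>auto simp: mult.commute\<close>)
      qed
    next
      case right
      show ?thesis
      proof (cases "t \<le> s")
        case True
        with right show ?thesis by (intro above) auto
      next
        case False
        have "s \<le> p" using right by (intro p_ge) auto
        show ?thesis
          by (rule remove[where l = 1 and k = 0 and s = s and r = 0 and c = "t - s" and A = 1 and D = "t - 2 * s"])
             (use right False \<open>s \<le> p\<close> potm(4)[of t s] in \<open>auto simp: mult.commute abs_minus_commute\<close>)
      qed
    next
      case mid
      have p: "s \<le> p" "p \<le> r" using mid by (auto intro: p_le p_ge)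
      consider "t \<le> s" | "r \<le> t" | "s < t" "t < r" by linarith
      then show ?thesis
      proof cases
        case 1
        with mid show ?thesis by (intro above) auto
      next
        case 2
        with mid show ?thesis by (intro below) auto
      next
        case 3
        \<comment> \<open>Weights that make t the mean of s and r. The weighted sum of the distances
          to s and r is the distance to t outside the interval and its chord inside; convexity of V
          gives the bound on \<open>V t\<close>.\<close>
        define l where "l = (r - t) / (r - s)"
        have l: "0 \<le> l" "l \<le> 1" "l * (r - s) = r - t" using 3 by (auto simp: l_def)
        then have t: "t = l * s + (1 - l) * r" by (simp add: algebra_simps)
        show ?thesis
        proof (rule remove[where l = l and k = "1 - l" and s = s and r = r and c = 0
                and A = "2 * l - 1" and D = "(1 - l) * r - l * s"])
          show "l * \<bar>x - s\<bar> + (1 - l) * \<bar>x - r\<bar> + 0 = (2 * l - 1) * x + ((1 - l) * r - l * s)"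
            if "x \<in> insert p J" for x
          proof -
            have "s \<le> x" "x \<le> r" using that p mid by auto
            then have "\<bar>x - s\<bar> = x - s" "\<bar>x - r\<bar> = r - x" by simp_all
            then show ?thesis by (simp only:) (simp add: algebra_simps)
          qed
          show "l * \<bar>x - s\<bar> + (1 - l) * \<bar>x - r\<bar> + 0 = \<bar>x - t\<bar>" if "x \<notin> J" for x
          proof -
            have "x \<le> s \<or> r < x" using that mid by auto
            then show ?thesis
            proof
              assume x: "x \<le> s"
              have "\<bar>x - s\<bar> = s - x" "\<bar>x - r\<bar> = r - x" "\<bar>x - t\<bar> = t - x" using x 3 by simp_all
              then show ?thesis by (simp only: t) (simp add: algebra_simps)
            next
              assume x: "r < x"
              have "\<bar>x - s\<bar> = x - s" "\<bar>x - r\<bar> = x - r" "\<bar>x - t\<bar> = x - t" using x 3 by simp_all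
              then show ?thesis by (simp only: t) (simp add: algebra_simps)
            qed
          qed
          show "V t \<le> l * V s + (1 - l) * V r + 0 * m"
            using pot_convexD[OF pot, of l "1 - l" s r] l(1,2) by (simp add: t[symmetric])
          show "0 \<le> l" "0 \<le> 1 - l" using l(1,2) by simp_all
        qed
      qed
    qed
    with that[OF _ measJ meanJ] show thesis by simp
  qed
qed

text \<open>\<open>R k\<close> is what is left after the first \<open>k\<close> atoms have been embedded.\<close>
lemma (in finite_borel_measure) successive_shadows:
  fixes m b \<alpha> p :: "nat \<Rightarrow> real" and V :: "nat \<Rightarrow> real \<Rightarrow> real"
  assumes atomless: "\<And>x. measure M {x} = 0" and int: "integrable M (\<lambda>x. x)"
    and pot: "\<And>k. pot (m k) (b k) (V k)" and \<alpha>: "\<And>k. 0 \<le> \<alpha> k"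
    and mass: "m 0 = measure M (space M)" "\<And>k. m k = \<alpha> k + m (Suc k)"
    and mean: "b 0 = (\<integral>x. x \<partial>M)" "\<And>k. b k = \<alpha> k * p k + b (Suc k)"
    and V: "\<And>t. V 0 t \<le> (\<integral>x. \<bar>x - t\<bar> \<partial>M)" "\<And>k t. V k t = \<alpha> k * \<bar>p k - t\<bar> + V (Suc k) t"
  obtains R :: "nat \<Rightarrow> real set" where "R 0 = UNIV" "\<And>k. R k \<in> sets borel" "decseq R"
    "\<And>k. measure M (R k) = m k" "\<And>k. (\<integral>x. indicator (R k) x * x \<partial>M) = b k"
    "\<And>k t. V k t \<le> (\<integral>x. indicator (R k) x * \<bar>x - t\<bar> \<partial>M)"
proof -
  note [measurable_cong] = M_is_borel
  \<comment> \<open>The clause for \<open>k = 0\<close> carries the initial value through the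
    dependent choice, which only promises some set satisfying \<open>P 0\<close>.\<close>
  define P where "P k R \<longleftrightarrow> R \<in> sets borel \<and> measure M R = m k \<and> (\<integral>x. indicator R x * x \<partial>M) = b k \<and>
    (\<forall>t. V k t \<le> (\<integral>x. indicator R x * \<bar>x - t\<bar> \<partial>M)) \<and> (k = 0 \<longrightarrow> R = UNIV)" for k and R :: "real set"
  have "\<exists>R. \<forall>k. P k (R k) \<and> R (Suc k) \<subseteq> R k"
  proof (rule dependent_nat_choice)
    show "\<exists>R. P 0 R" by (rule exI[of _ UNIV]) (use mass(1) mean(1) V(1) borel_UNIV in \<open>simp add: P_def\<close>)
  next
    fix R k assume "P k R"
    then have [measurable]: "R \<in> sets borel" and R: "measure M R = m k"
      "(\<integral>x. indicator R x * x \<partial>M) = b k" "\<And>t. V k t \<le> (\<integral>x. indicator R x * \<bar>x - t\<bar> \<partial>M)"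
      unfolding P_def by auto
    define N where "N = density M (\<lambda>x. ennreal (indicator R x))"
    interpret N: finite_borel_measure N
      unfolding N_def by (rule finite_borel_density_indicator) measurable
    have N_int: "(\<integral>x. f x \<partial>N) = (\<integral>x. indicator R x * f x \<partial>M)"
      if "f \<in> borel_measurable borel" for f :: "real \<Rightarrow> real"
      unfolding N_def using that by (intro integral_density_indicator) auto
    have me: "measure N A = measure M (R \<inter> A)" if "A \<in> sets borel" for A
      unfolding measure_def N_def using that by (subst emeasure_density_indicator) auto
    have le: "measure M (R \<inter> {x}) \<le> measure M {x}" for x by (intro finite_measure_mono) auto
    have 1: "measure N {x} = 0" for x
      using le[of x] atomless[of x] measure_nonneg[of M "R \<inter> {x}"] by (simp add: me)
    have 2: "integrable N (\<lambda>x. x)"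
      unfolding N_def using int by (intro integrable_density_indicator) auto
    have 3: "\<alpha> k + m (Suc k) = measure N (space N)" using me[of UNIV] R mass(2)[of k] N.borel_UNIV by simp
    have 4: "\<alpha> k * p k + b (Suc k) = (\<integral>x. x \<partial>N)" using R mean(2)[of k] by (simp add: N_int)
    have 5: "\<alpha> k * \<bar>p k - t\<bar> + V (Suc k) t \<le> (\<integral>x. \<bar>x - t\<bar> \<partial>N)" for t
      using R(3)[of t] V(2)[of k t] by (simp add: N_int)
    obtain J where J[measurable]: "J \<in> sets borel" and J': "measure N J = \<alpha> k" "(\<integral>x. indicator J x * x \<partial>N) = \<alpha> k * p k"
      "\<And>t. V (Suc k) t \<le> (\<integral>x. indicator (- J) x * \<bar>x - t\<bar> \<partial>N)"
      using N.shadow[OF 1 2 pot[of "Suc k"] \<alpha>[of k] 3 4 5] by blast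
    have "P (Suc k) (R - J)" unfolding P_def
    proof (intro conjI allI)
      have "measure M (R - J) = measure M R - measure M (R \<inter> J)"
        by (subst finite_measure_Diff[symmetric]) (auto intro!: arg_cong[where f = "measure M"])
      then show "measure M (R - J) = m (Suc k)" using R J'(1) mass(2)[of k] by (simp add: me)
      have "(\<integral>x. indicator (R - J) x * x \<partial>M) =
         (\<integral>x. indicator R x * x - indicator (R \<inter> J) x * x \<partial>M)"
        by (intro Bochner_Integration.integral_cong) (auto split: split_indicator)
      also have "\<dots> = b k - (\<integral>x. indicator (R \<inter> J) x * x \<partial>M)"
        using R integrable_indicator_times[OF int] by simp
      also have "(\<integral>x. indicator (R \<inter> J) x * x \<partial>M) = \<alpha> k * p k"
        using J'(2) by (simp add: N_int indicator_inter_arith mult.assoc)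
      finally show "(\<integral>x. indicator (R - J) x * x \<partial>M) = b (Suc k)" using mean(2)[of k] by simp
      have "(\<integral>x. indicator (- J) x * \<bar>x - t\<bar> \<partial>N) = (\<integral>x. indicator (R - J) x * \<bar>x - t\<bar> \<partial>M)" for t
        by (subst N_int) (auto intro!: Bochner_Integration.integral_cong split: split_indicator)
      then show "V (Suc k) t \<le> (\<integral>x. indicator (R - J) x * \<bar>x - t\<bar> \<partial>M)" for t using J'(3)[of t] by simp
    qed auto
    then show "\<exists>S. P (Suc k) S \<and> S \<subseteq> R" by blast
  qed
  then obtain R where R: "\<And>k. P k (R k)" "\<And>k. R (Suc k) \<subseteq> R k" by blast
  have "decseq R" by (rule decseq_SucI) (rule R)
  then show thesis using that[of R] R(1) unfolding P_def by blast
qed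

section \<open>Dyadic tiles\<close>

text \<open>Dyadic nesting: the index of the cell at the coarser level k is the integer quotient by
  \<open>2 ^ (n - k)\<close> of the index at level n.\<close>

lemma floor_scale_pow2:
  fixes x y :: real
  assumes "\<lfloor>2 ^ n * x\<rfloor> = \<lfloor>2 ^ n * y\<rfloor>" "k \<le> n"
  shows "\<lfloor>2 ^ k * x\<rfloor> = \<lfloor>2 ^ k * y\<rfloor>"
proof -
  have "\<lfloor>2 ^ k * z\<rfloor> = \<lfloor>2 ^ n * z\<rfloor> div 2 ^ (n - k)" for z :: real
  proof -
    have "2 ^ k * z = 2 ^ n * z / 2 ^ (n - k)" using assms(2) by (simp add: power_diff)
    then show ?thesis using floor_divide_real_eq_div[of "2 ^ (n - k)" "2 ^ n * z"] by simp
  qed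
  then show ?thesis using assms(1) by simp
qed

text \<open>The tiles are the maximal dyadic intervals of length at most 1 on which the larger endpoint
  value of \<open>U\<close> lies below \<open>W\<close>.\<close>
lemma dyadic_tiles:
  fixes U W :: "real \<Rightarrow> real"
  assumes cont: "continuous_on UNIV U" "continuous_on UNIV W"
  obtains P Q :: "real \<Rightarrow> real" where
    "P \<in> borel_measurable borel" "Q \<in> borel_measurable borel"
    "range P \<subseteq> \<rat>" "range Q \<subseteq> \<rat>"
    "\<And>x. P x \<le> x" "\<And>x. x < Q x" "\<And>x. Q x \<le> P x + 1"
    "\<And>x t. U x < W x \<Longrightarrow> P x \<le> t \<Longrightarrow> t \<le> Q x \<Longrightarrow> U (P x) < W t \<and> U (Q x) < W t"
    "\<And>x y. U x < W x \<Longrightarrow> U y < W y \<Longrightarrow> P x = P y \<and> Q x = Q y \<or> Q x \<le> P y \<or> Q y \<le> P x"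
proof -
  define lo where "lo n i = real_of_int i / 2 ^ n" for n :: nat and i :: int
  \<comment> \<open>Both end values of U lie below all of W on the closed cell, so every point of
    the chord of U over the cell does too.\<close>
  define G where "G n i \<longleftrightarrow> (\<forall>t\<in>{lo n i..lo n (i + 1)}. U (lo n i) < W t \<and> U (lo n (i + 1)) < W t)" for n i
  define fl where "fl n x = \<lfloor>2 ^ n * x\<rfloor>" for n and x :: real
  \<comment> \<open>The least good level makes the tile maximal, which keeps overlapping tiles
    equal; levels start at 0, whence the length bound 1. Where no level is good the value is
    unspecified, but the enclosure of x and the length bound hold at every level.\<close>
  define lev where "lev x = (LEAST n. G n (fl n x))" for x
  define P where "P x = lo (lev x) (fl (lev x) x)" for x
  define Q where "Q x = lo (lev x) (fl (lev x) x + 1)" for x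
  have lo: "lo n (fl n x) \<le> x" "x < lo n (fl n x + 1)" for n x
    unfolding lo_def fl_def by (simp_all add: field_simps) linarith+
  have lo1: "lo n (i + 1) = lo n i + 1 / 2 ^ n" for n i by (simp add: lo_def field_simps)
  have fl_eq: "fl n z = i" if "lo n i \<le> z" "z < lo n (i + 1)" for n i z
    using that unfolding lo_def fl_def by (intro floor_unique) (simp_all add: field_simps)
  have ex: "\<exists>n. G n (fl n x)" if "U x < W x" for x
  proof -
    \<comment> \<open>A value strictly between U x and W x separates the two functions near x, so
      every sufficiently short cell around x is good.\<close>
    define c where "c = (U x + W x) / 2"
    have lim: "(U \<longlongrightarrow> U x) (nhds x)" "(W \<longlongrightarrow> W x) (nhds x)"
      using cont by (auto simp: continuous_on_eq_continuous_at isCont_def tendsto_at_iff_tendsto_nhds)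
    have "U x < c" "c < W x" using that by (simp_all add: c_def)
    then have "\<forall>\<^sub>F t in nhds x. U t < c" "\<forall>\<^sub>F t in nhds x. c < W t"
      using order_tendstoD(2)[OF lim(1)] order_tendstoD(1)[OF lim(2)] by auto
    then have "\<forall>\<^sub>F t in nhds x. U t < c \<and> c < W t" by eventually_elim simp
    then obtain d where d: "d > 0" "\<And>t. dist t x < d \<Longrightarrow> U t < c \<and> c < W t"
      by (auto simp: eventually_nhds_metric)
    obtain n where "1 / 2 ^ n < d" using real_arch_pow_inv[of d "1/2"] d by (auto simp: power_divide)
    then have "dist t x < d" if "lo n (fl n x) \<le> t" "t \<le> lo n (fl n x + 1)" for t
      using that lo(1)[of n x] lo(2)[of x n] unfolding lo1 dist_real_def by linarith
    moreover have "lo n (fl n x) \<le> lo n (fl n x + 1)" by (simp add: lo1)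
    ultimately have "G n (fl n x)" unfolding G_def using d(2)
      by (metis atLeastAtMost_iff less_trans order_refl)
    then show ?thesis ..
  qed
  have good: "G (lev x) (fl (lev x) x)" if "U x < W x" for x
    using LeastI_ex[OF ex[OF that]] unfolding lev_def .
  \<comment> \<open>By nesting, z and x share their cells at all levels up to \<open>lev x\<close>,
    so they have the same least good level.\<close>
  have lev: "lev z = lev x" "fl (lev x) z = fl (lev x) x"
    if x: "U x < W x" and "P x \<le> z" "z < Q x" for x z
  proof -
    show *: "fl (lev x) z = fl (lev x) x" using that by (intro fl_eq) (auto simp: P_def Q_def)
    have eq: "fl k z = fl k x" if "k \<le> lev x" for k
      using floor_scale_pow2[OF _ that, of z x] * by (simp add: fl_def)
    show "lev z = lev x" unfolding lev_def[of z]
    proof (rule Least_equality)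
      show "G (lev x) (fl (lev x) z)" using good[OF x] * by simp
      fix k assume k: "G k (fl k z)"
      show "lev x \<le> k"
      proof (rule ccontr)
        assume "\<not> lev x \<le> k"
        then have "G k (fl k x)" "k < lev x" using k eq[of k] by auto
        then show False using not_less_Least unfolding lev_def by blast
      qed
    qed
  qed
  have [measurable]: "fl n \<in> measurable borel (count_space UNIV)" for n
    unfolding fl_def by measurable
  have [measurable]: "lev \<in> measurable borel (count_space UNIV)"
    unfolding lev_def by measurable
  show thesis
  proof
    show "P \<in> borel_measurable borel" "Q \<in> borel_measurable borel"
      unfolding P_def Q_def by measurable
    show "range P \<subseteq> \<rat>" "range Q \<subseteq> \<rat>" by (auto simp: P_def Q_def lo_def)
    show PQ: "P x \<le> x" "x < Q x" for x using lo by (auto simp: P_def Q_def)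
    show "Q x \<le> P x + 1" for x by (simp add: P_def Q_def lo1)
    show "U (P x) < W t \<and> U (Q x) < W t" if "U x < W x" "P x \<le> t" "t \<le> Q x" for x t
      using good[OF that(1)] that(2,3) unfolding G_def P_def Q_def by simp
    show "P x = P y \<and> Q x = Q y \<or> Q x \<le> P y \<or> Q y \<le> P x" if x: "U x < W x" and y: "U y < W y" for x y
    proof (rule ccontr)
      assume not: "\<not> ?thesis"
      \<comment> \<open>The larger left end is a common point of two overlapping half-open tiles,
        and a tile is determined by any of its points.\<close>
      define z where "z = max (P x) (P y)"
      have "P x \<le> z" "z < Q x" "P y \<le> z" "z < Q y"
        using not PQ[of x] PQ[of y] by (auto simp: z_def)
      with lev[OF x, of z] lev[OF y, of z] not show False by (auto simp: P_def Q_def)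
    qed
  qed
qed

section \<open>Martingale couplings\<close>

lemma mart_coupling_imp_cx_le:
  fixes \<mu> \<nu> :: "real measure" and M :: "'a measure"
  assumes "mart_coupling M X Y \<mu> \<nu>"
  shows "cx_le \<mu> \<nu>"
proof -
  from assms have M: "prob_space M" and X[measurable]: "X \<in> borel_measurable M"
    and Y[measurable]: "Y \<in> borel_measurable M" and \<mu>: "\<mu> = distr M borel X" and \<nu>: "\<nu> = distr M borel Y"
    and iY: "integrable M Y" 
    and ce: "AE \<omega> in M. real_cond_exp M (vimage_algebra (space M) X borel) Y \<omega> = X \<omega>"
    unfolding mart_coupling_def by auto
  let ?F = "vimage_algebra (space M) X borel"
  interpret prob_space M by fact
  interpret S: finite_measure_subalgebra M ?F
  proof
    show "subalgebra M ?F" unfolding subalgebra_def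
      by (simp add: sets_image_in_sets)
  qed
  \<comment> \<open>X inherits integrability from Y, being almost surely its conditional
    expectation.\<close>
  have iX: "integrable M X"
    using integrable_cong_AE_imp[OF S.real_cond_exp_int(1)[OF iY] X] ce by auto
  have "(\<integral>x. h x \<partial>\<mu>) \<le> (\<integral>x. h x \<partial>\<nu>)"
    if h: "convex_on UNIV h" "integrable \<mu> h" "integrable \<nu> h" for h
  proof -
    have hb[measurable]: "h \<in> borel_measurable borel" using h(2) \<mu> by (auto dest: borel_measurable_integrable)
    have ihX: "integrable M (\<lambda>\<omega>. h (X \<omega>))" using h(2) unfolding \<mu> by (simp add: integrable_distr_eq)
    have ihY: "integrable M (\<lambda>\<omega>. h (Y \<omega>))" using h(3) unfolding \<nu> by (simp add: integrable_distr_eq)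
    have "AE \<omega> in M. h (real_cond_exp M ?F Y \<omega>) \<le> real_cond_exp M ?F (\<lambda>\<omega>. h (Y \<omega>)) \<omega>"
      by (rule S.real_cond_exp_jensens_inequality(2)[OF iY, of UNIV]) (use ihY h in auto)
    with ce have "AE \<omega> in M. h (X \<omega>) \<le> real_cond_exp M ?F (\<lambda>\<omega>. h (Y \<omega>)) \<omega>"
      by eventually_elim simp
    then have "(\<integral>\<omega>. h (X \<omega>) \<partial>M) \<le> (\<integral>\<omega>. real_cond_exp M ?F (\<lambda>\<omega>. h (Y \<omega>)) \<omega> \<partial>M)"
      by (rule integral_mono_AE[OF ihX S.real_cond_exp_int(1)[OF ihY]])
    also have "\<dots> = (\<integral>\<omega>. h (Y \<omega>) \<partial>M)" by (rule S.real_cond_exp_int(2)[OF ihY])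
    finally show ?thesis unfolding \<mu> \<nu> by (simp add: integral_distr)
  qed
  then show ?thesis using iX iY unfolding cx_le_def \<mu> \<nu> by (auto simp: integrable_distr_eq)
qed

text \<open>Fubini for a kernel and a signed, unbounded f, as needed for the first moment: the
  nonnegative version is applied to the positive and negative parts, whose inner integrals are
  finite almost everywhere.\<close>

lemma integral_bind_integrable:
  fixes f :: "'b \<Rightarrow> real"
  assumes N[measurable]: "N \<in> measurable M (subprob_algebra B)" and f[measurable]: "f \<in> borel_measurable B"
    and i: "integrable (M \<bind> N) f"
  shows "(\<integral>y. f y \<partial>(M \<bind> N)) = (\<integral>x. (\<integral>y. f y \<partial>N x) \<partial>M)"
proof -
  \<comment> \<open>\<open>ennreal\<close> sends negative numbers to 0, so s = 1 and s = -1 pick out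
    the positive and negative part; \<open>enn2real\<close> replaces infinite inner integrals by 0,
    which matters only on a null set.\<close>
  define p where "p s x = enn2real (\<integral>\<^sup>+y. ennreal (s * f y) \<partial>N x)" for s x
  have [measurable]: "p s \<in> borel_measurable M" for s unfolding p_def by measurable
  have fin: "(\<integral>\<^sup>+x. \<integral>\<^sup>+y. ennreal (s * f y) \<partial>N x \<partial>M) < \<infinity>" if "s \<in> {1, -1}" for s
  proof -
    have "(\<integral>\<^sup>+x. \<integral>\<^sup>+y. ennreal (s * f y) \<partial>N x \<partial>M) = (\<integral>\<^sup>+y. ennreal (s * f y) \<partial>(M \<bind> N))"
      by (rule nn_integral_bind[symmetric, OF _ N]) measurable
    also have "\<dots> \<le> (\<integral>\<^sup>+y. ennreal (norm (f y)) \<partial>(M \<bind> N))"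
      using that by (intro nn_integral_mono) (auto intro!: ennreal_leI)
    also have "\<dots> < \<infinity>" using i by (simp add: integrable_iff_bounded)
    finally show ?thesis .
  qed
  have ae: "AE x in M. (\<integral>\<^sup>+y. ennreal (s * f y) \<partial>N x) = ennreal (p s x)" if "s \<in> {1, -1}" for s
  proof -
    have "AE x in M. (\<integral>\<^sup>+y. ennreal (s * f y) \<partial>N x) \<noteq> \<infinity>"
      using fin[OF that] by (intro nn_integral_PInf_AE) auto
    then show ?thesis by eventually_elim (simp add: p_def less_top)
  qed
  have pi: "(\<integral>\<^sup>+x. ennreal (p s x) \<partial>M) = (\<integral>\<^sup>+y. ennreal (s * f y) \<partial>(M \<bind> N))" if "s \<in> {1, -1}" for s
  proof -
    have "(\<integral>\<^sup>+x. ennreal (p s x) \<partial>M) = (\<integral>\<^sup>+x. \<integral>\<^sup>+y. ennreal (s * f y) \<partial>N x \<partial>M)"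
      using ae[OF that] by (intro nn_integral_cong_AE) auto
    also have "\<dots> = (\<integral>\<^sup>+y. ennreal (s * f y) \<partial>(M \<bind> N))"
      by (rule nn_integral_bind[symmetric, OF _ N]) measurable
    finally show ?thesis .
  qed
  have nn: "0 \<le> p s x" for s x by (simp add: p_def)
  have ip: "integrable M (p s)" if "s \<in> {1, -1}" for s
  proof (rule integrableI_nonneg)
    have "(\<integral>\<^sup>+x. ennreal (p s x) \<partial>M) = (\<integral>\<^sup>+x. \<integral>\<^sup>+y. ennreal (s * f y) \<partial>N x \<partial>M)"
      using ae[OF that] by (intro nn_integral_cong_AE) auto
    then show "(\<integral>\<^sup>+x. ennreal (p s x) \<partial>M) < \<infinity>" using fin[OF that] by simp
  qed (use nn in auto)
  have int_p: "(\<integral>x. p s x \<partial>M) = enn2real (\<integral>\<^sup>+y. ennreal (s * f y) \<partial>(M \<bind> N))" if "s \<in> {1, -1}" for s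
    using pi[OF that] nn by (subst integral_eq_nn_integral) auto
  have "AE x in M. (\<integral>\<^sup>+y. ennreal (norm (f y)) \<partial>N x) \<noteq> \<infinity>"
  proof (rule nn_integral_PInf_AE)
    have "(\<integral>\<^sup>+x. \<integral>\<^sup>+y. ennreal (norm (f y)) \<partial>N x \<partial>M) = (\<integral>\<^sup>+y. ennreal (norm (f y)) \<partial>(M \<bind> N))"
      by (rule nn_integral_bind[symmetric, OF _ N]) measurable
    then show "(\<integral>\<^sup>+x. \<integral>\<^sup>+y. ennreal (norm (f y)) \<partial>N x \<partial>M) \<noteq> \<infinity>"
      using i by (simp add: integrable_iff_bounded less_top)
  qed measurable
  moreover have "AE x in M. f \<in> borel_measurable (N x)"
    by (rule AE_I2) (use N f in \<open>auto simp: subprob_measurableD(2) cong: measurable_cong_sets\<close>)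
  ultimately have "AE x in M. (\<integral>y. f y \<partial>N x) = p 1 x - p (- 1) x"
  proof eventually_elim
    case (elim x)
    then have "integrable (N x) f" by (simp add: integrable_iff_bounded less_top)
    then show ?case by (simp add: real_lebesgue_integral_def p_def)
  qed
  then have "(\<integral>x. (\<integral>y. f y \<partial>N x) \<partial>M) = (\<integral>x. p 1 x - p (- 1) x \<partial>M)"
    by (intro integral_cong_AE) auto
  also have "\<dots> = (\<integral>y. f y \<partial>(M \<bind> N))"
    using i ip int_p by (simp add: real_lebesgue_integral_def)
  finally show ?thesis ..
qed

text \<open>The coupling lives on the plane with the coordinates as X and Y. The law
  \<open>L x\<close> puts K x on the vertical line over x, so the kernel is the conditional law of
  the second coordinate by construction.\<close>

lemma mart_coupling_kernel:
  fixes \<mu> \<nu> :: "real measure"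
  assumes \<mu>: "prob_space \<mu>" "sets \<mu> = sets borel" and \<nu>: "sets \<nu> = sets borel"
    and int: "integrable \<mu> (\<lambda>x. x)" "integrable \<nu> (\<lambda>x. x)"
    and K: "K \<in> borel \<rightarrow>\<^sub>M prob_algebra borel"
    and marg: "\<And>B. B \<in> sets borel \<Longrightarrow> (\<integral>\<^sup>+x. emeasure (K x) B \<partial>\<mu>) = emeasure \<nu> B"
    and mean: "AE x in \<mu>. (\<integral>y. y \<partial>K x) = x"
    and shape: "AE x in \<mu>. K x = return borel x \<or> absolutely_continuous lborel (K x)"
  shows "mart_coupling (\<mu> \<bind> (\<lambda>x. distr (K x) (borel \<Otimes>\<^sub>M borel) (Pair x))) fst snd \<mu> \<nu>"
proof -
  define L where "L x = distr (K x) (borel \<Otimes>\<^sub>M borel) (Pair x)" for x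
  define M where "M = \<mu> \<bind> L"
  interpret \<mu>: prob_space \<mu> by fact
  note [measurable_cong] = \<mu>(2)
  have [measurable]: "L \<in> borel \<rightarrow>\<^sub>M prob_algebra (borel \<Otimes>\<^sub>M borel)"
    unfolding L_def using K by measurable
  have L_\<mu>[measurable]: "L \<in> \<mu> \<rightarrow>\<^sub>M prob_algebra (borel \<Otimes>\<^sub>M borel)" by measurable
  note L_sub[measurable] = measurable_prob_algebraD[OF L_\<mu>]
  have U: "space \<mu> = UNIV" using sets_eq_imp_space_eq[OF \<mu>(2)] by simp
  have SK: "sets (K x) = sets borel" "prob_space (K x)" for x
    using measurable_space[OF K, of x] by (auto simp: space_prob_algebra)
  have [measurable_cong]: "sets (K x) = sets borel" for x by (rule SK)
  have UK: "space (K x) = UNIV" for x using sets_eq_imp_space_eq[OF SK(1)[of x]] by simp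
  have [measurable]: "Pair x \<in> K x \<rightarrow>\<^sub>M borel \<Otimes>\<^sub>M borel" for x by measurable
  have SM[measurable_cong]: "sets M = sets (borel \<Otimes>\<^sub>M borel)"
    unfolding M_def by (rule sets_bind[OF _ \<mu>.not_empty]) (simp add: L_def)
  have "space M = space (borel \<Otimes>\<^sub>M borel)" by (rule sets_eq_imp_space_eq[OF SM])
  then have UM: "space M = UNIV" by (simp add: space_pair_measure)
  interpret M: prob_space M
    unfolding M_def
    by (rule \<mu>.prob_space_bind[OF _ L_sub]) (auto simp: L_def intro!: prob_space.prob_space_distr SK)
  have L_rect: "emeasure (L x) (A \<times> B) = indicator A x * emeasure (K x) B"
    if [measurable]: "A \<in> sets borel" "B \<in> sets borel" for x A B
  proof -
    have "Pair x -` (A \<times> B) \<inter> space (K x) = (if x \<in> A then B else {})" using UK by auto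
    then show ?thesis unfolding L_def by (subst emeasure_distr) auto
  qed
  have M_rect: "emeasure M (A \<times> B) = (\<integral>\<^sup>+x. indicator A x * emeasure (K x) B \<partial>\<mu>)"
    if "A \<in> sets borel" "B \<in> sets borel" for A B
    unfolding M_def using that by (subst emeasure_bind[OF \<mu>.not_empty L_sub]) (auto simp: L_rect)
  have fst: "distr M borel fst = \<mu>"
  proof (rule measure_eqI)
    fix A assume "A \<in> sets (distr M borel fst)"
    then have [measurable]: "A \<in> sets borel" by simp
    have "fst -` A \<inter> space M = A \<times> UNIV" by (auto simp: UM)
    then have "emeasure (distr M borel fst) A = emeasure M (A \<times> UNIV)"
      by (subst emeasure_distr) auto
    also have "\<dots> = (\<integral>\<^sup>+x. indicator A x \<partial>\<mu>)"
      using prob_space.emeasure_space_1[OF SK(2)] UK by (subst M_rect) auto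
    finally show "emeasure (distr M borel fst) A = emeasure \<mu> A" by simp
  qed (use \<mu> in simp)
  have snd: "distr M borel snd = \<nu>"
  proof (rule measure_eqI)
    fix B assume "B \<in> sets (distr M borel snd)"
    then have [measurable]: "B \<in> sets borel" by simp
    have "snd -` B \<inter> space M = UNIV \<times> B" by (auto simp: UM)
    then have "emeasure (distr M borel snd) B = emeasure M (UNIV \<times> B)"
      by (subst emeasure_distr) auto
    then show "emeasure (distr M borel snd) B = emeasure \<nu> B"
      by (simp add: M_rect marg)
  qed (use \<nu> in simp)
  have m_fst[measurable]: "fst \<in> borel_measurable M" and m_snd[measurable]: "snd \<in> borel_measurable M"
    by measurable
  have i_fst: "integrable M fst"
    using integrable_distr[OF m_fst, of "\<lambda>x. x"] int(1) unfolding fst by blast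
  have i_snd: "integrable M snd"
    using integrable_distr[OF m_snd, of "\<lambda>x. x"] int(2) unfolding snd by blast
  let ?F = "vimage_algebra (space M) fst borel"
  interpret S: finite_measure_subalgebra M ?F
  proof
    show "subalgebra M ?F" unfolding subalgebra_def
      by (intro conjI space_vimage_algebra sets_image_in_sets refl m_fst)
  qed
  have "AE \<omega> in M. real_cond_exp M ?F snd \<omega> = fst \<omega>"
  proof (rule S.real_cond_exp_charact)
    fix A assume "A \<in> sets ?F"
    \<comment> \<open>Events generated by the first coordinate are vertical strips over a Borel set
      B, so the martingale property reduces to integrating the mean of K x over B.\<close>
    then obtain B where [measurable]: "B \<in> sets borel" and A: "A = fst -` B"
      by (auto simp: sets_vimage_algebra2 UM)
    have "(\<integral>\<omega>\<in>A. snd \<omega> \<partial>M) = (\<integral>\<omega>. indicator B (fst \<omega>) * snd \<omega> \<partial>M)"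
      unfolding set_lebesgue_integral_def A by (simp add: indicator_def)
    also have "\<dots> = (\<integral>x. (\<integral>\<omega>. indicator B (fst \<omega>) * snd \<omega> \<partial>L x) \<partial>\<mu>)"
      unfolding M_def
    proof (rule integral_bind_integrable[OF L_sub])
      have "integrable M (\<lambda>\<omega>. indicator (fst -` B) \<omega> * snd \<omega>)"
        by (rule integrable_indicator_times[OF i_snd]) (use measurable_sets[of fst M borel B] in \<open>simp add: UM\<close>)
      then show "integrable (\<mu> \<bind> L) (\<lambda>\<omega>. indicator B (fst \<omega>) * snd \<omega> :: real)"
        unfolding M_def by (simp add: indicator_def)
    qed measurable
    also have "\<dots> = (\<integral>x. indicator B x * (\<integral>y. y \<partial>K x) \<partial>\<mu>)"
      by (intro Bochner_Integration.integral_cong) (simp_all add: L_def integral_distr)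
    also have "\<dots> = (\<integral>x. indicator B x * x \<partial>\<mu>)"
    proof (rule integral_cong_AE)
      show "AE x in \<mu>. indicator B x * (\<integral>y. y \<partial>K x) = indicator B x * x"
        using mean by eventually_elim simp
      have "(\<lambda>x. \<integral>y. y \<partial>K x) \<in> borel_measurable borel"
        using measurable_prob_algebraD[OF K] by measurable
      then show "(\<lambda>x. indicator B x * (\<integral>y. y \<partial>K x)) \<in> borel_measurable \<mu>" by measurable
    qed measurable
    also have "\<dots> = (\<integral>\<omega>. indicator B (fst \<omega>) * fst \<omega> \<partial>M)"
      unfolding fst[symmetric] by (subst integral_distr) auto
    also have "\<dots> = (\<integral>\<omega>\<in>A. fst \<omega> \<partial>M)"
      unfolding set_lebesgue_integral_def A by (simp add: indicator_def)
    finally show "(\<integral>\<omega>\<in>A. snd \<omega> \<partial>M) = (\<integral>\<omega>\<in>A. fst \<omega> \<partial>M)" .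
  next
    show "fst \<in> borel_measurable ?F" by (rule measurable_vimage_algebra1) (simp add: UM)
  qed (use i_fst i_snd in auto)
  moreover have "measure M {\<omega> \<in> space M. fst \<omega> \<in> A \<and> snd \<omega> \<in> B}
      = (\<integral>x. indicator A x * measure (K x) B \<partial>\<mu>)"
    if [measurable]: "A \<in> sets borel" "B \<in> sets borel" for A B
  proof -
    have "{\<omega> \<in> space M. fst \<omega> \<in> A \<and> snd \<omega> \<in> B} = A \<times> B" by (auto simp: UM)
    moreover have "measure (L x) (A \<times> B) = indicator A x * measure (K x) B" for x
      by (simp add: measure_def L_rect split: split_indicator)
    ultimately show ?thesis
      unfolding M_def by (simp add: \<mu>.measure_bind[OF L_sub])
  qed
  ultimately have "mart_coupling M fst snd \<mu> \<nu>"
    unfolding mart_coupling_def using K fst snd i_snd shape M.prob_space_axioms by auto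
  then show ?thesis unfolding M_def L_def .
qed

section \<open>Splitting the points of the tiles\<close>

text \<open>A point \<open>x\<close> sends the weight \<open>a x\<close> to the rational point \<open>Z x\<close>; rationals are numbered by
  \<^const>\<open>to_nat_on\<close>.\<close>
locale rational_transport = prob_space M for M :: "real measure" +
  fixes a Z :: "real \<Rightarrow> real"
  assumes sets_M: "sets M = sets borel"
    and a[measurable]: "a \<in> borel_measurable borel" and a01: "\<And>x. 0 \<le> a x" "\<And>x. a x \<le> 1"
    and Z[measurable]: "Z \<in> borel_measurable borel" and ratZ: "range Z \<subseteq> \<rat>"
    and intZ: "integrable M Z"
begin

definition idx :: "real \<Rightarrow> nat" where "idx x = to_nat_on \<rat> (Z x)"

definition atom :: "nat \<Rightarrow> real" where "atom k = (\<integral>x. a x * indicator {k} (idx x) \<partial>M)"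

text \<open>Integral of g against the transported mass sitting at targets numbered k or higher. The
  choices 1, identity and distance give mass, first moment and potential.\<close>

definition tail :: "(real \<Rightarrow> real) \<Rightarrow> nat \<Rightarrow> real" where
  "tail g k = (\<integral>x. (a x * indicator {k..} (idx x)) * g (Z x) \<partial>M)"

lemma Z_idx: "from_nat_into \<rat> (idx x) = Z x"
  unfolding idx_def by (rule from_nat_into_to_nat_on[OF countable_rat subsetD[OF ratZ rangeI]])

lemma idx_eq_iff: "idx x = k \<longleftrightarrow> Z x = from_nat_into \<rat> k"
proof -
  have "infinite (\<rat> :: real set)" using Rats_infinite .
  then show ?thesis using Z_idx[of x] by (auto simp: idx_def to_nat_on_from_nat_into_infinite countable_rat)
qed

lemma measurable_idx[measurable]: "idx \<in> borel \<rightarrow>\<^sub>M count_space UNIV"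
proof (rule measurable_count_space_eq2_countable[THEN iffD2])
  show "idx \<in> space borel \<rightarrow> UNIV \<and> (\<forall>k\<in>UNIV. idx -` {k} \<inter> space borel \<in> sets borel)"
  proof safe
    fix k
    have "idx -` {k} \<inter> space borel = Z -` {from_nat_into \<rat> k} \<inter> space borel"
      using idx_eq_iff by auto
    also have "\<dots> \<in> sets borel" by measurable
    finally show "idx -` {k} \<inter> space borel \<in> sets borel" .
  qed auto
qed

lemma integrable_a:
  assumes "integrable M f"
  shows "integrable M (\<lambda>x. (a x * indicator A (idx x)) * f x)"
proof (rule Bochner_Integration.integrable_bound[OF assms])
  note [measurable_cong] = sets_M
  have [measurable]: "f \<in> borel_measurable M" using assms by auto
  have [measurable]: "A \<in> sets (count_space UNIV)" by simp
  show "(\<lambda>x. a x * indicator A (idx x) * f x) \<in> borel_measurable M" by measurable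
  show "AE x in M. norm (a x * indicator A (idx x) * f x) \<le> norm (f x)"
    using a01 by (auto simp: abs_mult mult_left_le_one_le split: split_indicator)
qed

lemma atom_nonneg: "0 \<le> atom k"
  unfolding atom_def using a01 by simp

lemma tail_Suc:
  assumes "integrable M (\<lambda>x. g (Z x))"
  shows "tail g k = atom k * g (from_nat_into \<rat> k) + tail g (Suc k)"
proof -
  have i: "integrable M (\<lambda>x. (a x * indicator A (idx x)) * 1)" for A by (rule integrable_a) simp
  have "tail g k = (\<integral>x. (a x * indicator {k} (idx x)) * g (from_nat_into \<rat> k)
      + (a x * indicator {Suc k..} (idx x)) * g (Z x) \<partial>M)"
    unfolding tail_def
  proof (rule Bochner_Integration.integral_cong[OF refl])
    show "(a x * indicator {k..} (idx x)) * g (Z x) = (a x * indicator {k} (idx x)) * g (from_nat_into \<rat> k)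
      + (a x * indicator {Suc k..} (idx x)) * g (Z x)" for x
      using Z_idx[of x] by (cases "idx x = k") (auto split: split_indicator)
  qed
  also have "\<dots> = atom k * g (from_nat_into \<rat> k) + tail g (Suc k)"
    using i[of "{k}"] integrable_a[OF assms] by (simp add: atom_def tail_def)
  finally show ?thesis .
qed

lemma tail_LIMSEQ:
  assumes "integrable M (\<lambda>x. g (Z x))"
  shows "tail g \<longlonglongrightarrow> 0"
proof -
  have "(\<lambda>k. \<integral>x. (a x * indicator {k..} (idx x)) * g (Z x) \<partial>M) \<longlonglongrightarrow> (\<integral>x. 0 \<partial>M)"
  proof (rule integral_dominated_convergence[where w = "\<lambda>x. norm (g (Z x))"])
    show "AE x in M. (\<lambda>k. (a x * indicator {k..} (idx x)) * g (Z x)) \<longlonglongrightarrow> 0"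
    proof (rule AE_I2, rule tendsto_eventually, rule eventually_sequentiallyI)
      fix x k assume "Suc (idx x) \<le> k"
      then show "(a x * indicator {k..} (idx x)) * g (Z x) = 0" by simp
    qed
    show "AE x in M. norm (a x * indicator {k..} (idx x) * g (Z x)) \<le> norm (g (Z x))" for k
      using a01 by (auto simp: abs_mult mult_left_le_one_le split: split_indicator)
    show "(\<lambda>x. a x * indicator {k..} (idx x) * g (Z x)) \<in> borel_measurable M" for k
      using integrable_a[OF assms] by (rule borel_measurable_integrable)
  qed (use assms in auto)
  then show ?thesis by (simp add: tail_def[abs_def])
qed

lemma pot_tail: "pot (tail (\<lambda>_. 1) k) (tail (\<lambda>z. z) k) (\<lambda>t. tail (\<lambda>z. \<bar>z - t\<bar>) k)"
proof -
  have "integrable M (\<lambda>x. a x * indicator {k..} (idx x))"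
    using integrable_a[of "\<lambda>_. 1" "{k..}"] by simp
  from pot_integral[OF this integrable_a[OF intZ]] show ?thesis
    using a01 by (simp add: tail_def)
qed

text \<open>Only the number of the target matters to c, so the transported mass may be collected
  target by target. This computes the second marginal of the kernel.\<close>

lemma nn_integral_idx:
  fixes c :: "nat \<Rightarrow> ennreal"
  shows "(\<integral>\<^sup>+x. ennreal (a x) * c (idx x) \<partial>M) = (\<Sum>k. ennreal (atom k) * c k)"
proof -
  note [measurable_cong] = sets_M
  have i: "integrable M (\<lambda>x. (a x * indicator A (idx x)) * 1)" for A by (rule integrable_a) simp
  have [measurable]: "(\<lambda>x. indicator {k} (idx x) :: real) \<in> borel_measurable borel" for k
    by (rule measurable_compose[OF measurable_idx]) simp
  have [measurable]: "(\<lambda>x. ennreal (a x * indicator {k} (idx x))) \<in> borel_measurable M" for k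
    by measurable
  have "ennreal (a x) * c (idx x) = (\<Sum>k. ennreal (a x * indicator {k} (idx x)) * c k)" for x
    by (subst suminf_finite[of "{idx x}"]) auto
  then have "(\<integral>\<^sup>+x. ennreal (a x) * c (idx x) \<partial>M)
      = (\<integral>\<^sup>+x. (\<Sum>k. ennreal (a x * indicator {k} (idx x)) * c k) \<partial>M)" by simp
  also have "\<dots> = (\<Sum>k. \<integral>\<^sup>+x. ennreal (a x * indicator {k} (idx x)) * c k \<partial>M)"
    by (rule nn_integral_suminf) simp
  also have "\<dots> = (\<Sum>k. ennreal (atom k) * c k)"
  proof (rule suminf_cong)
    fix k
    have "(\<integral>\<^sup>+x. ennreal (a x * indicator {k} (idx x)) \<partial>M) = ennreal (atom k)"
      unfolding atom_def using i[of "{k}"] a01 by (intro nn_integral_eq_integral) auto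
    then show "(\<integral>\<^sup>+x. ennreal (a x * indicator {k} (idx x)) * c k \<partial>M) = ennreal (atom k) * c k"
      by (subst nn_integral_multc) auto
  qed
  finally show ?thesis .
qed

text \<open>There are only countably many targets, so the points sending weight to some massless
  target form a null set. Massless targets may therefore be given any default law.\<close>

lemma AE_atom_pos: "AE x in M. a x = 0 \<or> 0 < atom (idx x)"
proof -
  note [measurable_cong] = sets_M
  have i: "integrable M (\<lambda>x. (a x * indicator A (idx x)) * 1)" for A by (rule integrable_a) simp
  have "AE x in M. atom k = 0 \<longrightarrow> a x * indicator {k} (idx x) = 0" for k
  proof (cases "atom k = 0")
    case True
    then have "AE x in M. a x * indicator {k} (idx x) = 0"
      unfolding atom_def using i[of "{k}"] a01
      by (subst (asm) integral_nonneg_eq_0_iff_AE) auto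
    then show ?thesis by eventually_elim simp
  qed simp
  then have "AE x in M. \<forall>k. atom k = 0 \<longrightarrow> a x * indicator {k} (idx x) = 0"
    by (simp add: AE_all_countable)
  then show ?thesis
  proof eventually_elim
    case (elim x)
    then show ?case using atom_nonneg[of "idx x"] by (cases "atom (idx x) = 0") auto
  qed
qed

end

section \<open>Equality of potentials spreads from a closed support to the line\<close>

text \<open>V comes from mass on F only, so it is affine on each gap of F, with slope of modulus
  \<open>measure M F\<close> on unbounded gaps. W is convex and has that Lipschitz constant, so from
  its values at the ends of a gap it cannot exceed V inside.\<close>

lemma potential_eq_if_eq_on_support:
  fixes M :: "real measure"
  assumes M: "finite_measure M" "integrable M (\<lambda>x. x)" and F: "closed F" "F \<in> sets M"
  defines "V \<equiv> \<lambda>t. \<integral>x. indicator F x * \<bar>x - t\<bar> \<partial>M"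
  assumes W: "pot (measure M F) b W" and le: "\<And>t. V t \<le> W t" and eq: "\<And>t. t \<in> F \<Longrightarrow> V t = W t"
  shows "V t = W t"
proof (cases "t \<in> F")
  case False
  interpret finite_measure M by fact
  have i: "integrable M (\<lambda>x. indicator F x * \<bar>x - s\<bar>)" for s
    using M F by (intro integrable_indicator_times) auto
  have iF: "integrable M (indicat_real F)"
    using F(2) by (simp add: integrable_indicator_iff emeasure_eq_measure)
  have mF: "F \<inter> space M = F" using F(2) by simp
  \<comment> \<open>The ends of the gap around t are the supremum of A and the infimum of C, which
    lie in F as F is closed; an empty side means an unbounded gap.\<close>
  define A C where "A = F \<inter> {..t}" and "C = F \<inter> {t..}"
  have A: "Sup A \<in> F" "Sup A \<le> t" "\<And>x. x \<in> F \<Longrightarrow> x \<le> t \<Longrightarrow> x \<le> Sup A" if "A \<noteq> {}"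
  proof -
    have bdd: "bdd_above A" by (auto simp: A_def)
    have "Sup A \<in> A" using F(1) that bdd by (intro closed_contains_Sup) (auto simp: A_def intro!: closed_Int)
    then show "Sup A \<in> F" "Sup A \<le> t" by (auto simp: A_def)
    show "x \<le> Sup A" if "x \<in> F" "x \<le> t" for x
      using that by (intro cSup_upper bdd) (auto simp: A_def)
  qed
  have C: "Inf C \<in> F" "t \<le> Inf C" "\<And>x. x \<in> F \<Longrightarrow> t \<le> x \<Longrightarrow> Inf C \<le> x" if "C \<noteq> {}"
  proof -
    have bdd: "bdd_below C" by (auto simp: C_def)
    have "Inf C \<in> C" using F(1) that bdd by (intro closed_contains_Inf) (auto simp: C_def intro!: closed_Int)
    then show "Inf C \<in> F" "t \<le> Inf C" by (auto simp: C_def)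
    show "Inf C \<le> x" if "x \<in> F" "t \<le> x" for x
      using that by (intro cInf_lower bdd) (auto simp: C_def)
  qed
  have "W t \<le> V t"
  proof (cases "A = {}"; cases "C = {}")
    assume "A = {}" "C = {}"
    then have "F = {}" unfolding A_def C_def by fastforce
    then show ?thesis using potD(5)[OF W] by (simp add: V_def)
  next
    assume AC: "A \<noteq> {}" "C = {}"
    define a where "a = Sup A"
    have a: "a \<in> F" "a \<le> t" "\<And>x. x \<in> F \<Longrightarrow> x \<le> a"
      using A AC unfolding a_def C_def by (auto simp: linorder_not_le[symmetric] disjoint_iff)
    \<comment> \<open>No point of F lies beyond a, so V grows from there with the steepest slope
      that \<open>pot\<close> permits for W.\<close>
    have "V t = (\<integral>x. indicator F x * \<bar>x - a\<bar> + indicator F x * (t - a) \<partial>M)"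
      unfolding V_def using a by (intro Bochner_Integration.integral_cong) (force split: split_indicator)+
    also have "\<dots> = V a + measure M F * (t - a)"
      unfolding V_def using i iF by (simp add: mF)
    finally show ?thesis using potD(4)[OF W, of t a] eq[OF a(1)] a(2) by simp
  next
    assume AC: "A = {}" "C \<noteq> {}"
    define c where "c = Inf C"
    have c: "c \<in> F" "t \<le> c" "\<And>x. x \<in> F \<Longrightarrow> c \<le> x"
      using C AC unfolding c_def A_def by (auto simp: linorder_not_le[symmetric] disjoint_iff)
    have "V t = (\<integral>x. indicator F x * \<bar>x - c\<bar> + indicator F x * (c - t) \<partial>M)"
      unfolding V_def using c by (intro Bochner_Integration.integral_cong) (force split: split_indicator)+
    also have "\<dots> = V c + measure M F * (c - t)"
      unfolding V_def using i iF by (simp add: mF)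
    finally show ?thesis using potD(4)[OF W, of t c] eq[OF c(1)] c(2) by simp
  next
    assume AC: "A \<noteq> {}" "C \<noteq> {}"
    define a c where "a = Sup A" and "c = Inf C"
    note A = A[OF AC(1), folded a_def] and C = C[OF AC(2), folded c_def]
    have t: "a < t" "t < c" using A(1,2) C(1,2) False by (metis order_le_less)+
    define l where "l = (c - t) / (c - a)"
    have l: "0 \<le> l" "l \<le> 1" "l * (c - a) = c - t" using t by (auto simp: l_def)
    then have tl: "t = l * a + (1 - l) * c" by (simp add: algebra_simps)
    have "indicator F x * \<bar>x - t\<bar> = l * (indicator F x * \<bar>x - a\<bar>) + (1 - l) * (indicator F x * \<bar>x - c\<bar>)" for x
    proof (cases "x \<in> F")
      case True
      then have "x \<le> a \<or> c \<le> x" using A(3)[of x] C(3)[of x] by linarith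
      then have "\<bar>x - t\<bar> = l * \<bar>x - a\<bar> + (1 - l) * \<bar>x - c\<bar>"
      proof
        assume x: "x \<le> a"
        have "\<bar>x - a\<bar> = a - x" "\<bar>x - c\<bar> = c - x" "\<bar>x - t\<bar> = t - x" using x t by simp_all
        then show ?thesis by (simp only: tl) (simp add: algebra_simps)
      next
        assume x: "c \<le> x"
        have "\<bar>x - a\<bar> = x - a" "\<bar>x - c\<bar> = x - c" "\<bar>x - t\<bar> = x - t" using x t by simp_all
        then show ?thesis by (simp only: tl) (simp add: algebra_simps)
      qed
      then show ?thesis using True by simp
    qed simp
    then have "V t = l * V a + (1 - l) * V c" unfolding V_def using i by simp
    then show ?thesis
      using pot_convexD[OF W, of l "1 - l" a c] l(1,2) eq A(1) C(1) by (simp add: tl[symmetric])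
  qed
  with le[of t] show ?thesis by simp
qed (rule eq)

section \<open>The split law and its potential\<close>

locale tiled_pair =
  \<mu>: prob_space \<mu> + \<nu>: prob_space \<nu> for \<mu> \<nu> :: "real measure" +
  fixes P Q :: "real \<Rightarrow> real" and U W :: "real \<Rightarrow> real" and F :: "real set"
  defines "U \<equiv> \<lambda>t. \<integral>x. \<bar>x - t\<bar> \<partial>\<mu>" and "W \<equiv> \<lambda>t. \<integral>x. \<bar>x - t\<bar> \<partial>\<nu>"
    and "F \<equiv> {t. U t = W t}"
  assumes sets_\<mu>: "sets \<mu> = sets borel" and sets_\<nu>: "sets \<nu> = sets borel"
    and ac: "absolutely_continuous lborel \<nu>"
    and int_\<mu>: "integrable \<mu> (\<lambda>x. x)" and int_\<nu>: "integrable \<nu> (\<lambda>x. x)"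
    and means: "(\<integral>x. x \<partial>\<mu>) = (\<integral>x. x \<partial>\<nu>)" and U_le_W: "\<And>t. U t \<le> W t"
    and P[measurable]: "P \<in> borel_measurable borel" and Q[measurable]: "Q \<in> borel_measurable borel"
    and rat: "range P \<subseteq> \<rat>" "range Q \<subseteq> \<rat>"
    and PQ: "\<And>x. P x \<le> x" "\<And>x. x < Q x" "\<And>x. Q x \<le> P x + 1"
    and tile: "\<And>x t. U x < W x \<Longrightarrow> P x \<le> t \<Longrightarrow> t \<le> Q x \<Longrightarrow> U (P x) < W t \<and> U (Q x) < W t"
    and tiles: "\<And>x y. U x < W x \<Longrightarrow> U y < W y \<Longrightarrow> P x = P y \<and> Q x = Q y \<or> Q x \<le> P y \<or> Q y \<le> P x"
begin

lemma pot_U: "pot 1 (\<integral>x. x \<partial>\<mu>) U"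
  using pot_integral[of \<mu> "\<lambda>_. 1" "\<lambda>x. x"] int_\<mu> by (simp add: U_def \<mu>.prob_space)

lemma pot_W: "pot 1 (\<integral>x. x \<partial>\<nu>) W"
  using pot_integral[of \<nu> "\<lambda>_. 1" "\<lambda>x. x"] int_\<nu> by (simp add: W_def \<nu>.prob_space)

lemma closed_F: "closed F"
  unfolding F_def
  by (intro closed_Collect_eq convex_on_continuous potD(3)[OF pot_U] potD(3)[OF pot_W]) auto

lemma F_borel[measurable]: "F \<in> sets borel"
  using closed_F by (rule borel_closed)

lemma notin_F: "x \<notin> F \<longleftrightarrow> U x < W x"
  using U_le_W[of x] by (auto simp: F_def)

text \<open>Barycentric weights: off F they form the law on the two tile ends whose mean is x; on F
  they vanish because nothing is split there.\<close>

definition wl where "wl x = indicator (- F) x * ((Q x - x) / (Q x - P x))"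
definition wr where "wr x = indicator (- F) x * ((x - P x) / (Q x - P x))"

lemma wl_bounds: "0 \<le> wl x" "wl x \<le> 1" and wr_bounds: "0 \<le> wr x" "wr x \<le> 1"
  using PQ(1,2)[of x] by (auto simp: wl_def wr_def divide_simps split: split_indicator)

lemma w_F: "x \<in> F \<Longrightarrow> wl x = 0" "x \<in> F \<Longrightarrow> wr x = 0"
  by (simp_all add: wl_def wr_def)

lemma w_sum: "wl x + wr x = indicator (- F) x"
  using PQ(1,2)[of x] by (auto simp: wl_def wr_def add_divide_distrib[symmetric] split: split_indicator)

lemma w_mean: "wl x * P x + wr x * Q x = indicator (- F) x * x"
proof -
  have "Q x - P x \<noteq> 0" using PQ(1,2)[of x] by simp
  then have "(Q x - x) / (Q x - P x) * P x + (x - P x) / (Q x - P x) * Q x = x"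
    by (simp add: divide_simps) (simp add: algebra_simps)
  then show ?thesis by (simp add: wl_def wr_def split: split_indicator)
qed

lemma wl_measurable[measurable]: "wl \<in> borel_measurable borel"
  and wr_measurable[measurable]: "wr \<in> borel_measurable borel"
  unfolding wl_def wr_def by measurable

lemma integrable_PQ: "integrable \<mu> P" "integrable \<mu> Q"
proof -
  note [measurable_cong] = sets_\<mu>
  have i: "integrable \<mu> (\<lambda>x. \<bar>x\<bar> + 1)" using int_\<mu> by auto
  \<comment> \<open>The bound 1 on the length of tiles is what makes the ends integrable.\<close>
  have "\<bar>P x\<bar> \<le> \<bar>x\<bar> + 1" "\<bar>Q x\<bar> \<le> \<bar>x\<bar> + 1" for x using PQ[of x] by auto
  then show "integrable \<mu> P" "integrable \<mu> Q"
    by (auto intro!: Bochner_Integration.integrable_bound[OF i])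
qed

sublocale l: rational_transport \<mu> wl P
  by standard (use sets_\<mu> wl_bounds rat integrable_PQ in auto)

sublocale r: rational_transport \<mu> wr Q
  by standard (use sets_\<mu> wr_bounds rat integrable_PQ in auto)

definition \<alpha> :: "nat \<Rightarrow> real" where "\<alpha> k = l.atom k + r.atom k"

text \<open>Integral of g against the split law with the atoms numbered below k removed; the measure
  itself is never formed.\<close>

definition rest :: "(real \<Rightarrow> real) \<Rightarrow> nat \<Rightarrow> real" where
  "rest g k = (\<integral>x. indicator F x * g x \<partial>\<mu>) + l.tail g k + r.tail g k"

abbreviation pt :: "nat \<Rightarrow> real" where "pt \<equiv> from_nat_into \<rat>"

lemma \<alpha>_nonneg: "0 \<le> \<alpha> k"
  by (simp add: \<alpha>_def l.atom_nonneg r.atom_nonneg)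

lemma rest_Suc:
  assumes "integrable \<mu> (\<lambda>x. g (P x))" "integrable \<mu> (\<lambda>x. g (Q x))"
  shows "rest g k = \<alpha> k * g (pt k) + rest g (Suc k)"
  unfolding rest_def \<alpha>_def l.tail_Suc[OF assms(1), of k] r.tail_Suc[OF assms(2), of k]
  by (simp add: algebra_simps)

lemma rest_LIMSEQ:
  assumes "integrable \<mu> (\<lambda>x. g (P x))" "integrable \<mu> (\<lambda>x. g (Q x))"
  shows "rest g \<longlonglongrightarrow> (\<integral>x. indicator F x * g x \<partial>\<mu>)"
  unfolding rest_def
  using tendsto_add[OF tendsto_add[OF tendsto_const l.tail_LIMSEQ[OF assms(1)]] r.tail_LIMSEQ[OF assms(2)]]
  by simp

lemma F_sets: "F \<in> sets \<mu>" using sets_\<mu> F_borel by simp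

lemma mass_F: "(\<integral>x. indicator F x * 1 \<partial>\<mu>) = measure \<mu> F"
proof -
  have "F \<inter> space \<mu> = F" using F_sets by simp
  then show ?thesis by simp
qed

lemma pot_rest: "pot (rest (\<lambda>_. 1) k) (rest (\<lambda>z. z) k) (\<lambda>t. rest (\<lambda>z. \<bar>z - t\<bar>) k)"
  unfolding rest_def mass_F
  using \<mu>.finite_measure_axioms int_\<mu> F_sets
  by (intro pot_add pot_indicator l.pot_tail r.pot_tail)

lemma rest_0:
  assumes "integrable \<mu> (\<lambda>x. g (P x))" "integrable \<mu> (\<lambda>x. g (Q x))" "integrable \<mu> g"
  shows "rest g 0 = (\<integral>x. indicator F x * g x + wl x * g (P x) + wr x * g (Q x) \<partial>\<mu>)"
  using l.integrable_a[OF assms(1), of UNIV] r.integrable_a[OF assms(2), of UNIV]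
    integrable_indicator_times[OF assms(3) F_sets]
  by (simp add: rest_def l.tail_def r.tail_def)

lemma rest_0_eq:
  assumes i: "integrable \<mu> (\<lambda>x. g (P x))" "integrable \<mu> (\<lambda>x. g (Q x))" "integrable \<mu> g"
    and g: "\<And>x. x \<notin> F \<Longrightarrow> wl x * g (P x) + wr x * g (Q x) = g x"
  shows "rest g 0 = (\<integral>x. g x \<partial>\<mu>)"
  unfolding rest_0[OF i]
  by (intro Bochner_Integration.integral_cong refl) (use g w_F in \<open>auto split: split_indicator\<close>)

lemma integrable_dists:
  "integrable \<mu> (\<lambda>x. \<bar>P x - t\<bar>)" "integrable \<mu> (\<lambda>x. \<bar>Q x - t\<bar>)" "integrable \<mu> (\<lambda>x. \<bar>x - t\<bar>)"
  using integrable_PQ int_\<mu> by auto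

text \<open>Splitting a point preserves its mean, and the distance to t is affine on a tile whose
  interior misses t; so no tile changes the integral.\<close>

lemma rest_0_outside:
  assumes t: "\<And>x. x \<notin> F \<Longrightarrow> t \<le> P x \<or> Q x \<le> t"
  shows "rest (\<lambda>z. \<bar>z - t\<bar>) 0 = U t"
  unfolding U_def
proof (rule rest_0_eq[OF integrable_dists])
  fix x assume x: "x \<notin> F"
  have s: "wl x + wr x = 1" and m: "wl x * P x + wr x * Q x = x"
    using w_sum[of x] w_mean[of x] x by simp_all
  from t[OF x] show "wl x * \<bar>P x - t\<bar> + wr x * \<bar>Q x - t\<bar> = \<bar>x - t\<bar>"
  proof
    assume "t \<le> P x"
    then have abs: "\<bar>P x - t\<bar> = P x - t" "\<bar>Q x - t\<bar> = Q x - t" "\<bar>x - t\<bar> = x - t"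
      using PQ(1,2)[of x] by auto
    have "wl x * (P x - t) + wr x * (Q x - t) = (wl x * P x + wr x * Q x) - (wl x + wr x) * t"
      by (simp add: algebra_simps)
    then show ?thesis unfolding abs s m by simp
  next
    assume "Q x \<le> t"
    then have abs: "\<bar>P x - t\<bar> = t - P x" "\<bar>Q x - t\<bar> = t - Q x" "\<bar>x - t\<bar> = t - x"
      using PQ(1,2)[of x] by auto
    have "wl x * (t - P x) + wr x * (t - Q x) = (wl x + wr x) * t - (wl x * P x + wr x * Q x)"
      by (simp add: algebra_simps)
    then show ?thesis unfolding abs s m by simp
  qed
qed

lemma between_tile_ends:
  assumes "P y \<le> t" "t \<le> Q y"
  obtains \<kappa> where "0 \<le> \<kappa>" "\<kappa> \<le> 1" "t = \<kappa> * P y + (1 - \<kappa>) * Q y"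
proof -
  have lt: "P y < Q y" using PQ(1,2)[of y] by linarith
  define \<kappa> where "\<kappa> = (Q y - t) / (Q y - P y)"
  have "0 \<le> \<kappa>" "\<kappa> \<le> 1" and *: "\<kappa> * (Q y - P y) = Q y - t"
    using lt assms by (auto simp: \<kappa>_def)
  moreover have "t = \<kappa> * P y + (1 - \<kappa>) * Q y" using * by (simp add: algebra_simps)
  ultimately show thesis using that by blast
qed

lemma convex_comb_less:
  fixes w :: real
  assumes "u < w" "v < w" "0 \<le> \<kappa>" "\<kappa> \<le> 1"
  shows "\<kappa> * u + (1 - \<kappa>) * v < w"
  using convex_bound_lt[of u w v \<kappa> "1 - \<kappa>"] assms by simp

text \<open>By convexity U lies below its chord over the tile, and that chord lies strictly below
  W.\<close>

lemma tile_disjoint_F: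
  assumes "y \<notin> F" "P y \<le> t" "t \<le> Q y"
  shows "t \<notin> F"
proof -
  obtain \<kappa> where \<kappa>: "0 \<le> \<kappa>" "\<kappa> \<le> 1" "t = \<kappa> * P y + (1 - \<kappa>) * Q y"
    by (rule between_tile_ends[OF assms(2,3)])
  have "U t \<le> \<kappa> * U (P y) + (1 - \<kappa>) * U (Q y)"
    using pot_convexD[OF pot_U, of \<kappa> "1 - \<kappa>" "P y" "Q y"] \<kappa>(1,2) by (simp add: \<kappa>(3)[symmetric])
  also have "\<dots> < W t"
    using tile[of y t] assms notin_F \<kappa> by (intro convex_comb_less) auto
  finally show ?thesis by (simp add: notin_F)
qed

lemma rest_0_F: "t \<in> F \<Longrightarrow> rest (\<lambda>z. \<bar>z - t\<bar>) 0 = U t"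
  using tile_disjoint_F by (intro rest_0_outside) (metis linear)

text \<open>Inside a tile the split potential is convex and agrees with U at both ends, hence lies
  below the chord of U and below W. At every other t it is U t.\<close>

lemma rest_0_le: "rest (\<lambda>z. \<bar>z - t\<bar>) 0 \<le> W t"
proof (cases "\<exists>y. y \<notin> F \<and> P y < t \<and> t < Q y")
  case True
  then obtain y where y: "y \<notin> F" "P y \<le> t" "t \<le> Q y" by force
  obtain \<kappa> where \<kappa>: "0 \<le> \<kappa>" "\<kappa> \<le> 1" "t = \<kappa> * P y + (1 - \<kappa>) * Q y"
    by (rule between_tile_ends[OF y(2,3)])
  have disj: "P x = P y \<and> Q x = Q y \<or> Q x \<le> P y \<or> Q y \<le> P x" if "x \<notin> F" for x
    using tiles[of x y] that y(1) notin_F by blast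
  have PQlt: "P z < Q z" for z using PQ(1,2)[of z] by linarith
  \<comment> \<open>Tiles do not overlap, so an end of one is interior to none.\<close>
  have ends: "rest (\<lambda>z. \<bar>z - P y\<bar>) 0 = U (P y)" "rest (\<lambda>z. \<bar>z - Q y\<bar>) 0 = U (Q y)"
    by (rule rest_0_outside; use disj PQlt in \<open>metis order_refl less_imp_le order_trans\<close>)+
  have "rest (\<lambda>z. \<bar>z - t\<bar>) 0 \<le> \<kappa> * U (P y) + (1 - \<kappa>) * U (Q y)"
    using pot_convexD[OF pot_rest[of 0], of \<kappa> "1 - \<kappa>" "P y" "Q y"] \<kappa>(1,2)
    by (simp add: \<kappa>(3)[symmetric] ends)
  also have "\<dots> < W t"
    using tile[of y t] y notin_F \<kappa> by (intro convex_comb_less) auto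
  finally show ?thesis by simp
next
  case False
  then have "rest (\<lambda>z. \<bar>z - t\<bar>) 0 = U t" by (intro rest_0_outside) force
  with U_le_W show ?thesis by simp
qed

section \<open>Embedding the atoms of the split law into \<nu>\<close>

sublocale \<nu>: finite_borel_measure \<nu>
  by standard (rule sets_\<nu>)

lemma \<nu>_atomless: "measure \<nu> {x} = 0"
proof -
  have "{x} \<in> null_sets lborel" by (rule null_setsI) auto
  then have "{x} \<in> null_sets \<nu>" using ac by (auto simp: absolutely_continuous_def)
  then show ?thesis by (simp add: measure_def null_setsD1)
qed

text \<open>\<open>S k\<close> is the piece of \<nu> removed for atom k and T is what no atom uses.
  In the limit T has the mass and mean of \<mu> on F and at least its potential; contact at the
  points of F turns that inequality into equality, so \<mu> on F is exactly \<nu> on T.\<close>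

lemma embedding:
  obtains S :: "nat \<Rightarrow> real set" where "\<And>k. S k \<in> sets borel"
    "\<And>k. measure \<nu> (S k) = \<alpha> k" "\<And>k. (\<integral>x. indicator (S k) x * x \<partial>\<nu>) = \<alpha> k * pt k"
    "\<And>B. B \<in> sets borel \<Longrightarrow> emeasure \<mu> (F \<inter> B) + (\<Sum>k. emeasure \<nu> (S k \<inter> B)) = emeasure \<nu> B"
proof -
  define m where "m = rest (\<lambda>_. 1)"
  define b where "b = rest (\<lambda>z. z)"
  define V where "V k t = rest (\<lambda>z. \<bar>z - t\<bar>) k" for k t
  have i1: "integrable \<mu> (\<lambda>x. 1 :: real)" by simp
  have m_Suc: "m k = \<alpha> k + m (Suc k)" for k
    unfolding m_def using rest_Suc[of "\<lambda>_. 1" k] by simp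
  have b_Suc: "b k = \<alpha> k * pt k + b (Suc k)" for k
    unfolding b_def using rest_Suc[of "\<lambda>z. z" k] integrable_PQ by simp
  have V_Suc: "V k t = \<alpha> k * \<bar>pt k - t\<bar> + V (Suc k) t" for k t
    unfolding V_def using rest_Suc[OF integrable_dists(1,2)] .
  have m_0: "m 0 = measure \<nu> (space \<nu>)"
    unfolding m_def using rest_0_eq[of "\<lambda>_. 1"] w_sum by (simp add: \<mu>.prob_space \<nu>.prob_space)
  have b_0: "b 0 = (\<integral>x. x \<partial>\<nu>)"
    unfolding b_def means[symmetric] using w_mean integrable_PQ int_\<mu> by (intro rest_0_eq) auto
  have V_0: "V 0 t \<le> (\<integral>x. \<bar>x - t\<bar> \<partial>\<nu>)" for t
    using rest_0_le[of t] by (simp add: V_def W_def)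
  have pot: "pot (m k) (b k) (V k)" for k unfolding m_def b_def V_def by (rule pot_rest)
  obtain R where R: "R 0 = UNIV" "\<And>k. R k \<in> sets borel" "decseq R"
    "\<And>k. measure \<nu> (R k) = m k" "\<And>k. (\<integral>x. indicator (R k) x * x \<partial>\<nu>) = b k"
    "\<And>k t. V k t \<le> (\<integral>x. indicator (R k) x * \<bar>x - t\<bar> \<partial>\<nu>)"
    using \<nu>.successive_shadows[OF \<nu>_atomless int_\<nu> pot \<alpha>_nonneg m_0 m_Suc b_0 b_Suc V_0 V_Suc] by blast
  note [measurable] = R(2)
  have R_\<nu>: "R k \<in> sets \<nu>" for k using R(2) sets_\<nu> by simp
  define T where "T = (\<Inter>k. R k)"
  have [measurable]: "T \<in> sets borel" unfolding T_def by measurable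
  have T_\<nu>: "T \<in> sets \<nu>" using sets_\<nu> by simp
  define S where "S k = R k - R (Suc k)" for k
  have [measurable]: "S k \<in> sets borel" for k unfolding S_def by measurable
  have S_\<nu>: "S k \<in> sets \<nu>" for k using sets_\<nu> by simp
  have sub: "R (Suc k) \<subseteq> R k" for k using R(3) by (simp add: decseq_SucD)
  have intS: "(\<integral>x. indicator (S k) x * f x \<partial>\<nu>)
      = (\<integral>x. indicator (R k) x * f x \<partial>\<nu>) - (\<integral>x. indicator (R (Suc k)) x * f x \<partial>\<nu>)"
    if "integrable \<nu> f" for f :: "real \<Rightarrow> real" and k
  proof -
    have "(\<integral>x. indicator (S k) x * f x \<partial>\<nu>)
        = (\<integral>x. indicator (R k) x * f x - indicator (R (Suc k)) x * f x \<partial>\<nu>)"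
      using sub[of k] by (intro Bochner_Integration.integral_cong) (auto simp: S_def split: split_indicator)
    then show ?thesis using integrable_indicator_times[OF that R_\<nu>] by simp
  qed
  have measS: "measure \<nu> (S k) = \<alpha> k" for k
    unfolding S_def using sub R_\<nu> R(4) m_Suc[of k] by (subst \<nu>.finite_measure_Diff) auto
  have meanS: "(\<integral>x. indicator (S k) x * x \<partial>\<nu>) = \<alpha> k * pt k" for k
    using intS[OF int_\<nu>, of k] R(5) b_Suc[of k] by simp
  have int_dist: "integrable \<nu> (\<lambda>x. \<bar>x - t\<bar>)" for t using int_\<nu> by auto
  have limT: "(\<lambda>k. \<integral>x. indicator (R k) x * f x \<partial>\<nu>) \<longlonglongrightarrow> (\<integral>x. indicator T x * f x \<partial>\<nu>)"
    if f: "integrable \<nu> f" for f :: "real \<Rightarrow> real"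
  proof (rule integral_dominated_convergence[where w = "\<lambda>x. norm (f x)"])
    show "(\<lambda>x. indicator T x * f x) \<in> borel_measurable \<nu>"
      by (rule borel_measurable_integrable[OF integrable_indicator_times[OF f T_\<nu>]])
    show "(\<lambda>x. indicator (R k) x * f x) \<in> borel_measurable \<nu>" for k
      by (rule borel_measurable_integrable[OF integrable_indicator_times[OF f R_\<nu>]])
    have "(\<lambda>k. indicator (R k) x * f x) \<longlonglongrightarrow> indicator T x * f x" for x
      unfolding T_def by (intro tendsto_mult tendsto_const LIMSEQ_indicator_decseq R(3))
    then show "AE x in \<nu>. (\<lambda>k. indicator (R k) x * f x) \<longlonglongrightarrow> indicator T x * f x" by simp
    show "AE x in \<nu>. norm (indicator (R k) x * f x) \<le> norm (f x)" for k
      by (auto split: split_indicator)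
  qed (use f in auto)
  have measT: "measure \<nu> T = measure \<mu> F"
  proof (rule LIMSEQ_unique)
    show "m \<longlonglongrightarrow> measure \<nu> T"
      using \<nu>.finite_Lim_measure_decseq[of R] R_\<nu> R(3) by (auto simp: R(4) T_def)
    show "m \<longlonglongrightarrow> measure \<mu> F"
      unfolding m_def using rest_LIMSEQ[of "\<lambda>_. 1", unfolded mass_F] by simp
  qed
  have meanT: "(\<integral>x. indicator T x * x \<partial>\<nu>) = (\<integral>x. indicator F x * x \<partial>\<mu>)"
  proof (rule LIMSEQ_unique)
    show "b \<longlonglongrightarrow> (\<integral>x. indicator T x * x \<partial>\<nu>)" using limT[OF int_\<nu>] by (simp add: R(5))
    show "b \<longlonglongrightarrow> (\<integral>x. indicator F x * x \<partial>\<mu>)"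
      unfolding b_def using rest_LIMSEQ[of "\<lambda>z. z"] integrable_PQ by simp
  qed
  have limV: "(\<lambda>k. V k t) \<longlonglongrightarrow> (\<integral>x. indicator F x * \<bar>x - t\<bar> \<partial>\<mu>)" for t
    unfolding V_def by (rule rest_LIMSEQ[OF integrable_dists(1,2)])
  have le_T: "(\<integral>x. indicator F x * \<bar>x - t\<bar> \<partial>\<mu>) \<le> (\<integral>x. indicator T x * \<bar>x - t\<bar> \<partial>\<nu>)" for t
    by (rule LIMSEQ_le[OF limV limT[OF int_dist]]) (use R(6) in blast)
  have eq_F: "(\<integral>x. indicator F x * \<bar>x - t\<bar> \<partial>\<mu>) = (\<integral>x. indicator T x * \<bar>x - t\<bar> \<partial>\<nu>)"
    if t: "t \<in> F" for t
  proof -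
    \<comment> \<open>At a contact point the two sides start equal. By Jensen, removing
      \<open>S k\<close> lowers the left side at least as much as removing its atom lowers V, while
      \<open>R(6)\<close> keeps the left side above V; so equality persists.\<close>
    have "(\<integral>x. indicator (R k) x * \<bar>x - t\<bar> \<partial>\<nu>) = V k t" for k
    proof (induction k)
      case 0
      show ?case using rest_0_F[OF t] t R(1) by (simp add: V_def F_def W_def)
    next
      case (Suc k)
      have "\<alpha> k * \<bar>pt k - t\<bar> = \<bar>\<alpha> k * pt k - \<alpha> k * t\<bar>"
        using \<alpha>_nonneg[of k] by (simp add: right_diff_distrib[symmetric] abs_mult)
      also have "\<dots> \<le> (\<integral>x. indicator (S k) x * \<bar>x - t\<bar> \<partial>\<nu>)"
        using potD(2)[OF pot_indicator[OF \<nu>.finite_measure_axioms int_\<nu> S_\<nu>], of k t]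
        by (simp add: measS meanS)
      finally show ?case using intS[OF int_dist, of k t] Suc R(6)[of "Suc k" t] V_Suc[of k t] by simp
    qed
    then have "(\<lambda>k. V k t) \<longlonglongrightarrow> (\<integral>x. indicator T x * \<bar>x - t\<bar> \<partial>\<nu>)"
      using limT[OF int_dist[of t]] by simp
    with limV[of t] show ?thesis by (rule LIMSEQ_unique)
  qed
  have eq: "(\<integral>x. indicator F x * \<bar>x - t\<bar> \<partial>\<mu>) = (\<integral>x. indicator T x * \<bar>x - t\<bar> \<partial>\<nu>)" for t
  proof (rule potential_eq_if_eq_on_support[OF \<mu>.finite_measure_axioms int_\<mu> closed_F F_sets])
    show "pot (measure \<mu> F) (\<integral>x. indicator T x * x \<partial>\<nu>) (\<lambda>t. \<integral>x. indicator T x * \<bar>x - t\<bar> \<partial>\<nu>)"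
      using pot_indicator[OF \<nu>.finite_measure_axioms int_\<nu> T_\<nu>] by (simp add: measT)
  qed (use le_T eq_F in auto)
  have em: "emeasure \<mu> (F \<inter> B) = emeasure \<nu> (T \<inter> B)" if "B \<in> sets borel" for B
  proof (rule emeasure_Int_eqI_potential)
    show "finite_borel_measure \<mu>" by unfold_locales (rule sets_\<mu>)
    show "finite_borel_measure \<nu>" by unfold_locales
  qed (use int_\<mu> int_\<nu> measT meanT eq that in auto)
  have "emeasure \<mu> (F \<inter> B) + (\<Sum>k. emeasure \<nu> (S k \<inter> B)) = emeasure \<nu> B"
    if [measurable]: "B \<in> sets borel" for B
  proof -
    have disj: "disjoint_family (\<lambda>k. S k \<inter> B)"
    proof -
      have "S i \<inter> S j = {}" if "i < j" for i j
        using decseqD[OF R(3), of "Suc i" j] that by (auto simp: S_def)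
      then show ?thesis unfolding disjoint_family_on_def by (auto simp: neq_iff)
    qed
    have "x \<in> T \<or> (\<exists>k. x \<in> S k)" for x
    proof (rule ccontr)
      assume *: "\<not> ?thesis"
      have "x \<in> R k" for k using * R(1) by (induction k) (auto simp: S_def)
      with * show False by (auto simp: T_def)
    qed
    then have "B = (T \<inter> B) \<union> (\<Union>k. S k \<inter> B)" by auto
    moreover have "emeasure \<nu> ((T \<inter> B) \<union> (\<Union>k. S k \<inter> B))
        = emeasure \<nu> (T \<inter> B) + emeasure \<nu> (\<Union>k. S k \<inter> B)"
      by (rule plus_emeasure[symmetric]) (auto simp: T_def S_def sets_\<nu>)
    moreover have "emeasure \<nu> (\<Union>k. S k \<inter> B) = (\<Sum>k. emeasure \<nu> (S k \<inter> B))"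
      by (rule suminf_emeasure[OF _ disj, symmetric]) (auto simp: sets_\<nu>)
    ultimately show ?thesis by (simp add: em)
  qed
  with that[of S] measS meanS show thesis by simp
qed

end

section \<open>The kernel\<close>

context tiled_pair
begin

lemma mart_coupling_exists: "\<exists>(M :: (real \<times> real) measure) X Y. mart_coupling M X Y \<mu> \<nu>"
proof -
  obtain S where S[measurable]: "\<And>k. S k \<in> sets borel"
    and measS: "\<And>k. measure \<nu> (S k) = \<alpha> k" and meanS: "\<And>k. (\<integral>x. indicator (S k) x * x \<partial>\<nu>) = \<alpha> k * pt k"
    and sumS: "\<And>B. B \<in> sets borel \<Longrightarrow> emeasure \<mu> (F \<inter> B) + (\<Sum>k. emeasure \<nu> (S k \<inter> B)) = emeasure \<nu> B"
    using embedding by blast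
  note [measurable_cong] = sets_\<mu> sets_\<nu>
  \<comment> \<open>Density of the normalised piece \<open>S k\<close> relative to \<nu>. The
    default 1 gives a massless target \<nu> itself, which keeps every mixture a probability law with
    a density.\<close>
  define d where "d k y = (if \<alpha> k = 0 then 1 else indicator (S k) y / \<alpha> k)" for k y
  define D where "D B k = (\<integral>\<^sup>+y. ennreal (d k y) * indicator B y \<partial>\<nu>)" for B k
  have d0: "0 \<le> d k y" for k y using \<alpha>_nonneg[of k] by (simp add: d_def)
  have [measurable]: "d k \<in> borel_measurable borel" for k unfolding d_def by measurable
  \<comment> \<open>This holds for the default density too, because \<open>S k\<close> is then a
    null set.\<close>
  have \<alpha>D: "ennreal (\<alpha> k) * D B k = emeasure \<nu> (S k \<inter> B)" if [measurable]: "B \<in> sets borel" for B k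
  proof (cases "\<alpha> k = 0")
    case True
    have "emeasure \<nu> (S k \<inter> B) \<le> emeasure \<nu> (S k)" by (intro emeasure_mono) auto
    then show ?thesis using True measS[of k] by (simp add: \<nu>.emeasure_eq_measure)
  next
    case False
    have "ennreal (\<alpha> k) * D B k = (\<integral>\<^sup>+y. ennreal (\<alpha> k) * (ennreal (d k y) * indicator B y) \<partial>\<nu>)"
      unfolding D_def by (rule nn_integral_cmult[symmetric]) measurable
    also have "\<dots> = (\<integral>\<^sup>+y. indicator (S k \<inter> B) y \<partial>\<nu>)"
      by (rule nn_integral_cong)
        (use False \<alpha>_nonneg[of k] in \<open>auto simp: d_def ennreal_mult[symmetric] split: split_indicator\<close>)
    finally show ?thesis by simp
  qed
  have D_UNIV: "D UNIV k = 1" for k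
  proof (cases "\<alpha> k = 0")
    case True
    then show ?thesis using \<nu>.emeasure_space_1 by (simp add: D_def d_def)
  next
    case False
    then have pos: "0 < \<alpha> k" using \<alpha>_nonneg[of k] by simp
    have "ennreal (\<alpha> k) * D UNIV k = ennreal (\<alpha> k) * 1"
      using \<alpha>D[of UNIV k] measS[of k] by (simp add: \<nu>.emeasure_eq_measure)
    then show ?thesis using pos by (simp only: ennreal_mult_cancel_left) auto
  qed
  define f where "f x y = wl x * d (l.idx x) y + wr x * d (r.idx x) y" for x y
  have f_meas[measurable]: "f x \<in> borel_measurable borel" for x unfolding f_def by measurable
  define K where "K x = (if x \<in> F then return borel x else density \<nu> (\<lambda>y. ennreal (f x y)))" for x
  have K_em: "emeasure (K x) B
      = indicator (F \<inter> B) x + ennreal (wl x) * D B (l.idx x) + ennreal (wr x) * D B (r.idx x)"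
    if [measurable]: "B \<in> sets borel" for x B
  proof (cases "x \<in> F")
    case True
    then show ?thesis by (simp add: K_def w_F indicator_def)
  next
    case False
    have "emeasure (K x) B = (\<integral>\<^sup>+y. ennreal (f x y) * indicator B y \<partial>\<nu>)"
      using False by (simp add: K_def emeasure_density)
    also have "\<dots> = (\<integral>\<^sup>+y. ennreal (wl x) * (ennreal (d (l.idx x) y) * indicator B y)
        + ennreal (wr x) * (ennreal (d (r.idx x) y) * indicator B y) \<partial>\<nu>)"
      using wl_bounds wr_bounds d0
      by (intro nn_integral_cong) (auto simp: f_def ennreal_mult split: split_indicator)
    also have "\<dots> = ennreal (wl x) * D B (l.idx x) + ennreal (wr x) * D B (r.idx x)"
      unfolding D_def by (subst nn_integral_add) (auto simp: nn_integral_cmult)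
    finally show ?thesis using False by simp
  qed
  have K_sets: "sets (K x) = sets borel" for x by (simp add: K_def sets_\<nu>)
  have K_prob: "prob_space (K x)" for x
  proof (rule prob_spaceI)
    have "emeasure (K x) UNIV = indicator F x + ennreal (wl x + wr x)"
      using wl_bounds[of x] wr_bounds[of x] by (simp add: K_em D_UNIV add.assoc)
    then show "emeasure (K x) (space (K x)) = 1"
      using sets_eq_imp_space_eq[OF K_sets[of x]] w_sum[of x] by (simp split: split_indicator)
  qed
  have idx_comp[measurable]: "(\<lambda>x. c (l.idx x)) \<in> borel_measurable borel" "(\<lambda>x. c (r.idx x)) \<in> borel_measurable borel"
    for c :: "nat \<Rightarrow> ennreal"
    by (rule measurable_compose[OF l.measurable_idx], simp) (rule measurable_compose[OF r.measurable_idx], simp)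
  have K: "K \<in> borel \<rightarrow>\<^sub>M prob_algebra borel"
  proof (rule measurable_prob_algebraI[OF K_prob], rule measurable_subprob_algebra)
    show "(\<lambda>x. emeasure (K x) B) \<in> borel_measurable borel" if [measurable]: "B \<in> sets borel" for B
      by (subst K_em) measurable
  qed (simp_all add: K_sets K_prob prob_space_imp_subprob_space)
  \<comment> \<open>Averaging over \<mu> turns the weights into atom masses; left and right shares
    of an atom add up to \<open>\<alpha> k\<close>, which undoes the normalisation of its piece, and
    \<open>sumS\<close> reassembles \<nu>.\<close>
  have marg: "(\<integral>\<^sup>+x. emeasure (K x) B \<partial>\<mu>) = emeasure \<nu> B" if [measurable]: "B \<in> sets borel" for B
  proof -
    have "(\<integral>\<^sup>+x. emeasure (K x) B \<partial>\<mu>) = emeasure \<mu> (F \<inter> B)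
        + (\<integral>\<^sup>+x. ennreal (wl x) * D B (l.idx x) \<partial>\<mu>) + (\<integral>\<^sup>+x. ennreal (wr x) * D B (r.idx x) \<partial>\<mu>)"
      unfolding K_em[OF that] by (simp add: nn_integral_add)
    also have "\<dots> = emeasure \<mu> (F \<inter> B) + ((\<Sum>k. ennreal (l.atom k) * D B k) + (\<Sum>k. ennreal (r.atom k) * D B k))"
      unfolding l.nn_integral_idx r.nn_integral_idx by (simp add: add.assoc)
    also have "\<dots> = emeasure \<mu> (F \<inter> B) + (\<Sum>k. ennreal (\<alpha> k) * D B k)"
      by (simp add: suminf_add[symmetric] \<alpha>_def l.atom_nonneg r.atom_nonneg distrib_right)
    finally show ?thesis by (simp add: \<alpha>D sumS)
  qed
  have int_d: "integrable \<nu> (\<lambda>y. d k y * y)" for k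
    using int_\<nu> integrable_indicator_times[OF int_\<nu>, of "S k"] by (cases "\<alpha> k = 0") (auto simp: d_def)
  have mean_d: "(\<integral>y. d k y * y \<partial>\<nu>) = pt k" if "0 < \<alpha> k" for k
    using that meanS[of k] by (simp add: d_def)
  have mean: "AE x in \<mu>. (\<integral>y. y \<partial>K x) = x"
    using l.AE_atom_pos r.AE_atom_pos
  proof eventually_elim
    case (elim x)
    show ?case
    proof (cases "x \<in> F")
      case True
      then show ?thesis by (simp add: K_def integral_return)
    next
      case False
      have "0 \<le> f x y" for y using wl_bounds wr_bounds d0 by (simp add: f_def)
      then have "(\<integral>y. y \<partial>K x) = (\<integral>y. f x y * y \<partial>\<nu>)"
        using False by (simp add: K_def integral_real_density)
      also have "\<dots> = wl x * (\<integral>y. d (l.idx x) y * y \<partial>\<nu>) + wr x * (\<integral>y. d (r.idx x) y * y \<partial>\<nu>)"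
        using int_d by (simp add: f_def distrib_right mult.assoc)
      also have "wl x * (\<integral>y. d (l.idx x) y * y \<partial>\<nu>) = wl x * P x"
        using elim(1) mean_d[of "l.idx x"] r.atom_nonneg[of "l.idx x"] by (auto simp: \<alpha>_def l.Z_idx)
      also have "wr x * (\<integral>y. d (r.idx x) y * y \<partial>\<nu>) = wr x * Q x"
        using elim(2) mean_d[of "r.idx x"] l.atom_nonneg[of "r.idx x"] by (auto simp: \<alpha>_def r.Z_idx)
      finally show ?thesis using False w_mean[of x] by simp
    qed
  qed
  have "K x = return borel x \<or> absolutely_continuous lborel (K x)" for x
  proof (cases "x \<in> F")
    case False
    \<comment> \<open>A density relative to \<nu> suffices, since \<nu> is absolutely continuous
      itself.\<close>
    have "absolutely_continuous \<nu> (density \<nu> (\<lambda>y. ennreal (f x y)))"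
      by (rule absolutely_continuousI_density) measurable
    with ac False show ?thesis unfolding K_def absolutely_continuous_def by auto
  qed (simp add: K_def)
  then have "AE x in \<mu>. K x = return borel x \<or> absolutely_continuous lborel (K x)" by simp
  from mart_coupling_kernel[OF \<mu>.prob_space_axioms sets_\<mu> sets_\<nu> int_\<mu> int_\<nu> K marg mean this]
  show ?thesis by blast
qed

end

section \<open>Equivalence of convex order and existence of the coupling\<close>

text \<open>An existential over probability spaces binds M at one type: the plane suffices to
  realise a coupling, and the second conjunct lets a coupling on a space of any type imply the
  order.\<close>

theorem theorem2:
  fixes \<mu> \<nu> :: "real measure"
  assumes "prob_space \<mu>" and "sets \<mu> = sets borel"
    and "prob_space \<nu>" and "sets \<nu> = sets borel"
    and "absolutely_continuous lborel \<nu>"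
  shows "(cx_le \<mu> \<nu> \<longleftrightarrow>
            (\<exists>(M :: (real \<times> real) measure) X Y. mart_coupling M X Y \<mu> \<nu>))
       \<and> (\<forall>(M :: 'a measure) X Y. mart_coupling M X Y \<mu> \<nu> \<longrightarrow> cx_le \<mu> \<nu>)"
proof (intro conjI iffI allI impI)
  assume "cx_le \<mu> \<nu>"
  then have int: "integrable \<mu> (\<lambda>x. x)" "integrable \<nu> (\<lambda>x. x)"
    and le: "\<And>h. convex_on UNIV h \<Longrightarrow> integrable \<mu> h \<Longrightarrow> integrable \<nu> h \<Longrightarrow> (\<integral>x. h x \<partial>\<mu>) \<le> (\<integral>x. h x \<partial>\<nu>)"
    unfolding cx_le_def by auto
  interpret \<mu>: prob_space \<mu> by fact
  interpret \<nu>: prob_space \<nu> by fact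
  define U where "U t = (\<integral>x. \<bar>x - t\<bar> \<partial>\<mu>)" for t
  define W where "W t = (\<integral>x. \<bar>x - t\<bar> \<partial>\<nu>)" for t
  have "pot 1 (\<integral>x. x \<partial>\<mu>) U" "pot 1 (\<integral>x. x \<partial>\<nu>) W"
    using pot_integral[of \<mu> "\<lambda>_. 1" "\<lambda>x. x"] pot_integral[of \<nu> "\<lambda>_. 1" "\<lambda>x. x"] int
    by (simp_all add: U_def[abs_def] W_def[abs_def] \<mu>.prob_space \<nu>.prob_space)
  then have cont: "continuous_on UNIV U" "continuous_on UNIV W"
    by (auto dest!: potD(3) intro: convex_on_continuous)
  have affine: "convex_on UNIV (\<lambda>x::real. c * x)" for c
    by (rule convex_onI) (simp_all add: algebra_simps)
  \<comment> \<open>Both x and -x are convex test functions, which forces equal means.\<close>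
  have means: "(\<integral>x. x \<partial>\<mu>) = (\<integral>x. x \<partial>\<nu>)"
    using le[OF affine[of 1]] le[OF affine[of "- 1"]] int by simp
  have U_le_W: "U t \<le> W t" for t
  proof -
    have "convex_on UNIV (\<lambda>x. \<bar>x - t\<bar>)"
      using convex_on_dist[of UNIV t] by (simp add: dist_real_def abs_minus_commute)
    then show ?thesis unfolding U_def W_def using int by (intro le) auto
  qed
  obtain P Q :: "real \<Rightarrow> real" where PQ:
    "P \<in> borel_measurable borel" "Q \<in> borel_measurable borel"
    "range P \<subseteq> \<rat>" "range Q \<subseteq> \<rat>"
    "\<And>x. P x \<le> x" "\<And>x. x < Q x" "\<And>x. Q x \<le> P x + 1"
    "\<And>x t. U x < W x \<Longrightarrow> P x \<le> t \<Longrightarrow> t \<le> Q x \<Longrightarrow> U (P x) < W t \<and> U (Q x) < W t"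
    "\<And>x y. U x < W x \<Longrightarrow> U y < W y \<Longrightarrow> P x = P y \<and> Q x = Q y \<or> Q x \<le> P y \<or> Q y \<le> P x"
    using dyadic_tiles[OF cont] by blast
  have UW: "U = (\<lambda>t. \<integral>x. \<bar>x - t\<bar> \<partial>\<mu>)" "W = (\<lambda>t. \<integral>x. \<bar>x - t\<bar> \<partial>\<nu>)"
    by (simp_all add: U_def W_def fun_eq_iff)
  interpret tiled_pair \<mu> \<nu> P Q U W "{t. U t = W t}"
    by unfold_locales
      (fact assms int means U_le_W[unfolded U_def W_def] PQ[unfolded U_def W_def] | simp only: UW)+
  show "\<exists>(M :: (real \<times> real) measure) X Y. mart_coupling M X Y \<mu> \<nu>"
    by (rule mart_coupling_exists)
next
  assume "\<exists>(M :: (real \<times> real) measure) X Y. mart_coupling M X Y \<mu> \<nu>"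
  then show "cx_le \<mu> \<nu>" by (auto intro: mart_coupling_imp_cx_le)
next
  fix M :: "'a measure" and X Y
  assume "mart_coupling M X Y \<mu> \<nu>"
  then show "cx_le \<mu> \<nu>" by (rule mart_coupling_imp_cx_le)
qed

end
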